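(* Let $E$ be an infinite dimensional reflexive Banach space. If $T: E\to c_0$ is a bounded linear operator and $K: E\to c_0$ is a compact linear operator such that $\|T \| < \|T+K\|$, then $T + K$ attains its norm. However, there exists a Banach space $E'$ isomorphic to $E$ such that the pair $(E', c_0)$ fails to have the WMP.
   Context: Banach spaces are over $\mathbb{K} = \mathbb{R}$ or $\mathbb{C}$; $c_0$ is the space of null sequences with the supremum norm; "isomorphic" means linearly homeomorphic. A bounded linear operator $T:E\to F$ attains its norm if there is $x_0$ in the unit sphere $S_E$ with $\|T(x_0)\|=\|T\|$. A maximizing sequence for $T$ is a sequence $(x_n)\subset S_E$ with $\|T(x_n)\|\to\|T\|$. A pair $(E,F)$ of Banach spaces has the weak maximizing property (WMP) if every bounded linear operator $T:E\to F$ that admits a non-weakly null maximizing sequence (i.e. one not converging weakly to $0$) attains its norm. *)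

theory Defs
  imports "HOL-Analysis.Analysis"
begin

text \<open>
  The scalar field is \<open>\<real>\<close> or \<open>\<complex>\<close>. The class axiom says exactly this, up to isometric
  isomorphism of fields, so that one statement covers both cases.
\<close>

class real_or_complex = real_normed_field +
  assumes isometric_real_or_complex:
    "\<exists>\<phi> :: 'a \<Rightarrow> complex.
       (\<forall>x y. \<phi> (x + y) = \<phi> x + \<phi> y) \<and> (\<forall>x y. \<phi> (x * y) = \<phi> x * \<phi> y) \<and>
       (\<forall>x. norm (\<phi> x) = norm x) \<and> (range \<phi> = \<real> \<or> range \<phi> = UNIV)"

instance real :: real_or_complex
  by standard (rule exI[of _ complex_of_real], auto simp: Reals_def)

instance complex :: real_or_complex
  by standard (rule exI[of _ id], auto)


section \<open>Normed and Banach spaces\<close>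

text \<open>
  The library's Banach spaces are real and carry one fixed norm per type. Here the scalar
  multiplication and the norm are parameters, so that the scalars may be complex and one can
  quantify over Banach spaces.
\<close>

locale normed_vs = vector_space scale
  for scale :: "'k::real_or_complex \<Rightarrow> 'a::ab_group_add \<Rightarrow> 'a" +
  fixes nrm :: "'a \<Rightarrow> real"
  assumes nrm_triangle: "nrm (x + y) \<le> nrm x + nrm y"
    and nrm_scale: "nrm (scale c x) = norm c * nrm x"
    and nrm_eq_0: "nrm x = 0 \<longleftrightarrow> x = 0"
begin

lemma nrm_minus: "nrm (- x) = nrm x"
  using nrm_scale[of "-1" x] by simp

lemma nrm_nonneg: "0 \<le> nrm x"
  using nrm_triangle[of x "- x"] nrm_minus[of x] nrm_eq_0[of 0] by simp

lemma Metric_space_nrm: "Metric_space UNIV (\<lambda>x y. nrm (x - y))"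
proof
  show "nrm (x - y) = nrm (y - x)" for x y
    using nrm_minus[of "x - y"] by simp
  show "nrm (x - z) \<le> nrm (x - y) + nrm (y - z)" for x y z
    using nrm_triangle[of "x - y" "y - z"] by simp
qed (simp_all add: nrm_nonneg nrm_eq_0)

end

definition norm_topology :: "('a::ab_group_add \<Rightarrow> real) \<Rightarrow> 'a topology"
  where "norm_topology nrm = Metric_space.mtopology UNIV (\<lambda>x y. nrm (x - y))"

locale banach_vs = normed_vs +
  assumes complete: "Metric_space.mcomplete UNIV (\<lambda>x y. nrm (x - y))"

definition infinite_dimensional :: "('k::field \<Rightarrow> 'a::ab_group_add \<Rightarrow> 'a) \<Rightarrow> bool"
  where "infinite_dimensional sE \<longleftrightarrow> \<not> (\<exists>B. finite_dimensional_vector_space sE B)"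


section \<open>Operators, duality, reflexivity\<close>

definition bounded_operator ::
    "('k::field \<Rightarrow> 'a::ab_group_add \<Rightarrow> 'a) \<Rightarrow> ('a \<Rightarrow> real) \<Rightarrow>
     ('k \<Rightarrow> 'b::ab_group_add \<Rightarrow> 'b) \<Rightarrow> ('b \<Rightarrow> real) \<Rightarrow> ('a \<Rightarrow> 'b) \<Rightarrow> bool"
  where "bounded_operator sE nE sF nF T \<longleftrightarrow>
    Vector_Spaces.linear sE sF T \<and> (\<exists>C. \<forall>x. nF (T x) \<le> C * nE x)"

definition operator_norm :: "('a \<Rightarrow> real) \<Rightarrow> ('b \<Rightarrow> real) \<Rightarrow> ('a \<Rightarrow> 'b) \<Rightarrow> real"
  where "operator_norm nE nF T = (SUP x \<in> {x. nE x \<le> 1}. nF (T x))"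

definition compact_operator ::
    "('k::field \<Rightarrow> 'a::ab_group_add \<Rightarrow> 'a) \<Rightarrow> ('a \<Rightarrow> real) \<Rightarrow>
     ('k \<Rightarrow> 'b::ab_group_add \<Rightarrow> 'b) \<Rightarrow> ('b \<Rightarrow> real) \<Rightarrow> ('a \<Rightarrow> 'b) \<Rightarrow> bool"
  where "compact_operator sE nE sF nF K \<longleftrightarrow>
    Vector_Spaces.linear sE sF K \<and>
    compactin (norm_topology nF) (norm_topology nF closure_of (K ` {x. nE x \<le> 1}))"

definition isomorphic_vs ::
    "('k::field \<Rightarrow> 'a::ab_group_add \<Rightarrow> 'a) \<Rightarrow> ('a \<Rightarrow> real) \<Rightarrow>
     ('k \<Rightarrow> 'b::ab_group_add \<Rightarrow> 'b) \<Rightarrow> ('b \<Rightarrow> real) \<Rightarrow> bool"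
  where "isomorphic_vs sE nE sF nF \<longleftrightarrow>
    (\<exists>\<phi>. Vector_Spaces.linear sE sF \<phi> \<and>
         homeomorphic_map (norm_topology nE) (norm_topology nF) \<phi>)"

definition dual ::
    "('k::real_normed_field \<Rightarrow> 'a::ab_group_add \<Rightarrow> 'a) \<Rightarrow> ('a \<Rightarrow> real) \<Rightarrow> ('a \<Rightarrow> 'k) set"
  where "dual sE nE = {f. bounded_operator sE nE (*) norm f}"

text \<open>
  The bidual consists of the bounded linear functionals on \<^const>\<open>dual\<close>. As this is a set of
  functions and not a type, linearity and boundedness are written out relative to it; the
  values of an element of \<open>bidual\<close> outside \<^const>\<open>dual\<close> are irrelevant.
\<close>

definition bidual ::
    "('k::real_normed_field \<Rightarrow> 'a::ab_group_add \<Rightarrow> 'a) \<Rightarrow> ('a \<Rightarrow> real) \<Rightarrow> (('a \<Rightarrow> 'k) \<Rightarrow> 'k) set"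
  where "bidual sE nE = {\<Phi>.
    (\<forall>f\<in>dual sE nE. \<forall>g\<in>dual sE nE. \<Phi> (\<lambda>x. f x + g x) = \<Phi> f + \<Phi> g) \<and>
    (\<forall>c. \<forall>f\<in>dual sE nE. \<Phi> (\<lambda>x. c * f x) = c * \<Phi> f) \<and>
    (\<exists>C. \<forall>f\<in>dual sE nE. norm (\<Phi> f) \<le> C * operator_norm nE norm f)}"

text \<open>Surjectivity of the canonical embedding into the bidual.\<close>

definition reflexive ::
    "('k::real_normed_field \<Rightarrow> 'a::ab_group_add \<Rightarrow> 'a) \<Rightarrow> ('a \<Rightarrow> real) \<Rightarrow> bool"
  where "reflexive sE nE \<longleftrightarrow>
    (\<forall>\<Phi>\<in>bidual sE nE. \<exists>x. \<forall>f\<in>dual sE nE. \<Phi> f = f x)"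

definition weakly_null ::
    "('k::real_normed_field \<Rightarrow> 'a::ab_group_add \<Rightarrow> 'a) \<Rightarrow> ('a \<Rightarrow> real) \<Rightarrow> (nat \<Rightarrow> 'a) \<Rightarrow> bool"
  where "weakly_null sE nE x \<longleftrightarrow> (\<forall>f\<in>dual sE nE. (\<lambda>n. f (x n)) \<longlonglongrightarrow> 0)"


section \<open>Norm attainment and the weak maximizing property\<close>

definition attains_norm :: "('a \<Rightarrow> real) \<Rightarrow> ('b \<Rightarrow> real) \<Rightarrow> ('a \<Rightarrow> 'b) \<Rightarrow> bool"
  where "attains_norm nE nF T \<longleftrightarrow> (\<exists>x. nE x = 1 \<and> nF (T x) = operator_norm nE nF T)"

definition maximizing_sequence ::
    "('a \<Rightarrow> real) \<Rightarrow> ('b \<Rightarrow> real) \<Rightarrow> ('a \<Rightarrow> 'b) \<Rightarrow> (nat \<Rightarrow> 'a) \<Rightarrow> bool"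
  where "maximizing_sequence nE nF T x \<longleftrightarrow>
    (\<forall>n. nE (x n) = 1) \<and> (\<lambda>n. nF (T (x n))) \<longlonglongrightarrow> operator_norm nE nF T"

definition weak_maximizing_property ::
    "('k::real_normed_field \<Rightarrow> 'a::ab_group_add \<Rightarrow> 'a) \<Rightarrow> ('a \<Rightarrow> real) \<Rightarrow>
     ('k \<Rightarrow> 'b::ab_group_add \<Rightarrow> 'b) \<Rightarrow> ('b \<Rightarrow> real) \<Rightarrow> bool"
  where "weak_maximizing_property sE nE sF nF \<longleftrightarrow>
    (\<forall>T. bounded_operator sE nE sF nF T \<and>
         (\<exists>x. maximizing_sequence nE nF T x \<and> \<not> weakly_null sE nE x)
       \<longrightarrow> attains_norm nE nF T)"


section \<open>The space of null sequences\<close>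

typedef (overloaded) 'k c0 = "{x :: nat \<Rightarrow> 'k::real_normed_vector. x \<longlonglongrightarrow> 0}"
  morphisms c0_seq Abs_c0
  by (rule exI[of _ "\<lambda>_. 0"]) simp

setup_lifting type_definition_c0

instantiation c0 :: (real_normed_vector) ab_group_add
begin

lift_definition zero_c0 :: "'a c0" is "\<lambda>_. 0"
  by simp

lift_definition plus_c0 :: "'a c0 \<Rightarrow> 'a c0 \<Rightarrow> 'a c0" is "\<lambda>x y n. x n + y n"
  by (rule tendsto_add_zero)

lift_definition uminus_c0 :: "'a c0 \<Rightarrow> 'a c0" is "\<lambda>x n. - x n"
  using tendsto_minus by fastforce

lift_definition minus_c0 :: "'a c0 \<Rightarrow> 'a c0 \<Rightarrow> 'a c0" is "\<lambda>x y n. x n - y n"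
  using tendsto_diff by fastforce

instance
  by standard (transfer; simp add: algebra_simps)+

end

lift_definition c0_scale :: "'k::real_normed_field \<Rightarrow> 'k c0 \<Rightarrow> 'k c0" is "\<lambda>c x n. c * x n"
  by (rule tendsto_mult_right_zero)

definition c0_norm :: "'k::real_normed_vector c0 \<Rightarrow> real"
  where "c0_norm x = (SUP n. norm (c0_seq x n))"

lemma c0_seq_tendsto: "c0_seq x \<longlonglongrightarrow> 0"
  using c0_seq[of x] by simp

lemma c0_bdd: "bdd_above (range (\<lambda>n. norm (c0_seq x n)))"
proof -
  have "Bseq (c0_seq x)"
    using c0_seq_tendsto convergentI convergent_imp_Bseq by blast
  then show ?thesis
    unfolding Bseq_def by (auto intro: bdd_aboveI)
qed

lemma norm_c0_seq_le: "norm (c0_seq x n) \<le> c0_norm x"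
  unfolding c0_norm_def by (rule cSUP_upper[OF _ c0_bdd]) simp

lemma c0_norm_le: "(\<And>n. norm (c0_seq x n) \<le> C) \<Longrightarrow> c0_norm x \<le> C"
  unfolding c0_norm_def by (rule cSUP_least) auto

interpretation c0: normed_vs "c0_scale :: 'k::real_or_complex \<Rightarrow> 'k c0 \<Rightarrow> 'k c0" c0_norm
proof
  fix a b :: 'k and x y :: "'k c0"
  show "c0_scale a (x + y) = c0_scale a x + c0_scale a y"
    by transfer (simp add: algebra_simps)
  show "c0_scale (a + b) x = c0_scale a x + c0_scale b x"
    by transfer (simp add: algebra_simps)
  show "c0_scale a (c0_scale b x) = c0_scale (a * b) x"
    by transfer (simp add: algebra_simps)
  show "c0_scale 1 x = x"
    by transfer simp
  show "c0_norm (x + y) \<le> c0_norm x + c0_norm y"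
    by (rule c0_norm_le)
      (simp add: plus_c0.rep_eq, meson add_mono norm_c0_seq_le norm_triangle_le)
  show "c0_norm x = 0 \<longleftrightarrow> x = 0"
  proof
    assume "c0_norm x = 0"
    then have "c0_seq x n = 0" for n
      using norm_c0_seq_le[of x n] by simp
    then show "x = 0"
      by transfer auto
  qed (simp add: c0_norm_def zero_c0.rep_eq)
  show "c0_norm (c0_scale a x) = norm a * c0_norm x"
  proof (cases "a = 0")
    case True
    then show ?thesis by (simp add: c0_norm_def c0_scale.rep_eq)
  next
    case False
    have "c0_norm (c0_scale a x) \<le> norm a * c0_norm x"
      by (rule c0_norm_le)
        (simp add: c0_scale.rep_eq norm_mult mult_left_mono norm_c0_seq_le)
    moreover have "c0_norm x \<le> c0_norm (c0_scale a x) / norm a"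
    proof (rule c0_norm_le)
      fix n
      show "norm (c0_seq x n) \<le> c0_norm (c0_scale a x) / norm a"
        using norm_c0_seq_le[of "c0_scale a x" n] False
        by (simp add: c0_scale.rep_eq norm_mult field_simps)
    qed
    ultimately show ?thesis
      using False by (simp add: field_simps)
  qed
qed

end

theory Submission
  imports Defs "HOL-Library.Function_Algebras" "HOL-Library.Diagonal_Subsequence"
begin

text \<open>
  An operator into \<open>c\<^sub>0\<close> is a pointwise null sequence of functionals, and its norm is the supremum
  of their norms. A compact perturbation changes these norms by a null sequence, so if it raises
  the supremum, the new supremum is attained by one of the functionals, which attains its norm by
  reflexivity.

  For the failure of the WMP, reflexivity yields functionals \<open>h\<^sub>n\<close> that are pointwise null but not
  norm null. Renorm the space as a maximum-norm sum of a line and a hyperplane \<open>ker g\<close>, move the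
  \<open>h\<^sub>n\<close> to functionals that vanish on the line, normalise them and multiply by \<open>1 - 1/(n+2)\<close>. Each
  coordinate of the resulting operator has norm below \<open>1\<close>, so the norm \<open>1\<close> is not attained, while
  adding the unit vector of the line to almost maximizing vectors of the hyperplane gives a
  maximizing sequence on which \<open>g\<close> is constantly \<open>1\<close>.
\<close>

section \<open>The Hahn-Banach theorem\<close>

text \<open>The Hahn-Banach theorem enters on two levels. On the space it supplies norming and
  separating functionals. On the dual it supplies elements of the bidual, which reflexivity turns
  into points of the space. The obstacle in finding the \<open>h n\<close> is that the space may be
  nonseparable, so a diagonal argument has no countable dense set to run on. It suffices that a
  countable set, together with the common kernel of a sequence of functionals, spans a dense
  subspace: on the kernel these functionals vanish anyway. Differences of consecutive members of a
  diagonal subsequence are then pointwise null, and a triangular choice keeps their norms at least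
  1. The maximum norm is chosen because adding the unit vector of the line to a vector in the unit
  ball of the hyperplane gives norm exactly 1, and functionals vanishing on the line do not notice
  the change. A positive norm in \<open>c0\<close> is the modulus of some coordinate; this is why
  coordinate norms below 1 exclude attainment even though they tend to 1.\<close>

definition sublinear :: "(real \<Rightarrow> 'a::ab_group_add \<Rightarrow> 'a) \<Rightarrow> ('a \<Rightarrow> real) \<Rightarrow> bool"
  where "sublinear s q \<longleftrightarrow>
    (\<forall>x y. q (x + y) \<le> q x + q y) \<and> (\<forall>r>0. \<forall>x. q (s r x) \<le> r * q x)"

context
  fixes s :: "real \<Rightarrow> 'a::ab_group_add \<Rightarrow> 'a"
  assumes vs: "vector_space s"
begin

interpretation vector_space s by (rule vs)

lemma sublinear_zero:
  assumes "sublinear s q"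
  shows "q 0 = 0"
proof -
  have "q (s 2 0) \<le> 2 * q 0" "q (s (1/2) 0) \<le> 1/2 * q 0"
    using assms unfolding sublinear_def by (meson zero_less_numeral half_gt_zero zero_less_one)+
  then show ?thesis by simp
qed

lemma sublinear_minus:
  assumes "sublinear s q"
  shows "- q (- x) \<le> q x"
proof -
  have "q (x + - x) \<le> q x + q (- x)"
    using assms unfolding sublinear_def by blast
  then show ?thesis using sublinear_zero[OF assms] by simp
qed

text \<open>The inequality for the factor \<open>1/r\<close> at the point \<open>s r x\<close> is
  the reverse inequality. The definition can therefore ask for one inequality only, which is what
  has to be checked for infima.\<close>

lemma sublinear_scale:
  assumes q: "sublinear s q" and "r > 0"
  shows "q (s r x) = r * q x"
proof -
  have "q (s (1/r) (s r x)) \<le> 1/r * q (s r x)"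
    using q \<open>r > 0\<close> unfolding sublinear_def by (meson zero_less_divide_1_iff)
  then have "r * q x \<le> q (s r x)" using \<open>r > 0\<close> by (simp add: field_simps)
  moreover have "q (s r x) \<le> r * q x"
    using q \<open>r > 0\<close> unfolding sublinear_def by blast
  ultimately show ?thesis by simp
qed

text \<open>Supplies the lower bounds for Zorn's lemma. The infimum is finite because every member
  lies above \<open>- p (- x)\<close>, and it stays subadditive because of any two members of a
  chain one lies below both.\<close>

lemma sublinear_INF_chain:
  assumes p: "sublinear s p" and ne: "C \<noteq> {}"
    and C: "\<And>q. q \<in> C \<Longrightarrow> sublinear s q \<and> q \<le> p"
    and chain: "\<And>q r. q \<in> C \<Longrightarrow> r \<in> C \<Longrightarrow> q \<le> r \<or> r \<le> q"
  shows "sublinear s (\<lambda>x. INF q\<in>C. q x)" "\<And>q. q \<in> C \<Longrightarrow> (\<lambda>x. INF q\<in>C. q x) \<le> q"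
proof -
  have bdd: "bdd_below ((\<lambda>q. q x) ` C)" for x
  proof (rule bdd_belowI2)
    fix q assume "q \<in> C"
    with C have "- q (- x) \<le> q x" "q (- x) \<le> p (- x)"
      using sublinear_minus by (auto simp: le_fun_def)
    then show "- p (- x) \<le> q x" by linarith
  qed
  show "(\<lambda>x. INF q\<in>C. q x) \<le> q" if "q \<in> C" for q
    using cINF_lower[OF bdd that] by (intro le_funI)
  show "sublinear s (\<lambda>x. INF q\<in>C. q x)"
    unfolding sublinear_def
  proof (intro conjI allI impI)
    fix x y
    have main: "(INF q\<in>C. q (x + y)) \<le> q1 x + q2 y" if "q1 \<in> C" "q2 \<in> C" for q1 q2
    proof -
      obtain q where q: "q \<in> C" "q \<le> q1" "q \<le> q2"
        using chain[OF \<open>q1 \<in> C\<close> \<open>q2 \<in> C\<close>] \<open>q1 \<in> C\<close> \<open>q2 \<in> C\<close> by blast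
      have "(INF q\<in>C. q (x + y)) \<le> q (x + y)"
        using q bdd by (auto intro: cINF_lower)
      also have "\<dots> \<le> q x + q y"
        using C q unfolding sublinear_def by blast
      also have "\<dots> \<le> q1 x + q2 y"
        using q by (auto simp: le_fun_def intro: add_mono)
      finally show ?thesis .
    qed
    have "(INF q\<in>C. q (x + y)) - q2 y \<le> (INF q\<in>C. q x)" if "q2 \<in> C" for q2
      using main that by (intro cINF_greatest[OF ne]) (simp add: diff_le_eq)
    then have "(INF q\<in>C. q (x + y)) - (INF q\<in>C. q x) \<le> (INF q\<in>C. q y)"
      by (intro cINF_greatest[OF ne]) (simp add: algebra_simps)
    then show "(INF q\<in>C. q (x + y)) \<le> (INF q\<in>C. q x) + (INF q\<in>C. q y)" by simp
  next
    fix r :: real and x assume r: "r > 0"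
    have "(INF q\<in>C. q (s r x)) / r \<le> (INF q\<in>C. q x)"
    proof (rule cINF_greatest[OF ne])
      fix q assume q: "q \<in> C"
      then have "(INF q\<in>C. q (s r x)) \<le> q (s r x)"
        using bdd by (auto intro: cINF_lower)
      also have "\<dots> = r * q x"
        using sublinear_scale C q r by blast
      finally show "(INF q\<in>C. q (s r x)) / r \<le> q x"
        using r by (simp add: field_simps)
    qed
    then show "(INF q\<in>C. q (s r x)) \<le> r * (INF q\<in>C. q x)"
      using r by (simp add: field_simps)
  qed
qed

text \<open>The witness is the infimum of \<open>q (x + s t y) - t * q y\<close> over
  \<open>t \<ge> 0\<close>, which lowers \<open>q\<close> as far as possible at \<open>- y\<close>.
  Taking \<open>t = 0\<close> gives \<open>q' \<le> q\<close>, taking \<open>t = 1\<close> at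
  \<open>- y\<close> gives one half of the equation, and the lower bound \<open>- q (- x)\<close>
  gives finiteness and the other half.\<close>

lemma sublinear_reduce:
  assumes q: "sublinear s q"
  obtains q' where "sublinear s q'" "q' \<le> q" "q' (- y) = - q y"
proof
  define B where "B x t = q (x + s t y) - t * q y" for x t
  define q' where "q' x = (INF t\<in>{0..}. B x t)" for x
  have pos: "q (s t x) = t * q x" if "t \<ge> 0" for t x
    using that sublinear_scale[OF q, of t x] sublinear_zero[OF q] by (cases "t = 0") auto
  have sub: "q (u + v) \<le> q u + q v" for u v
    using q unfolding sublinear_def by blast
  have lower: "- q (- x) \<le> B x t" if "t \<ge> 0" for x t
    using sub[of "x + s t y" "- x"] pos[OF that, of y] by (simp add: B_def)
  have bdd: "bdd_below (B x ` {0..})" for x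
    using lower by (intro bdd_belowI2) auto
  have le: "q' x \<le> B x t" if "t \<ge> 0" for x t
    unfolding q'_def using bdd that by (intro cINF_lower) auto
  show "q' \<le> q"
    using le[of 0] by (auto simp: le_fun_def B_def)
  have "q' (- y) \<le> - q y"
    using le[of 1 "- y"] sublinear_zero[OF q] by (simp add: B_def)
  moreover have "- q y \<le> q' (- y)"
    unfolding q'_def using lower[of _ "- y"] by (intro cINF_greatest) auto
  ultimately show "q' (- y) = - q y" by simp
  show "sublinear s q'"
    unfolding sublinear_def
  proof (intro conjI allI impI)
    fix u v
    have *: "q' (u + v) \<le> B u t + B v t'" if "t \<ge> 0" "t' \<ge> 0" for t t'
    proof -
      have "q' (u + v) \<le> B (u + v) (t + t')"
        using le that by simp
      also have "\<dots> \<le> B u t + B v t'"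
        using sub[of "u + s t y" "v + s t' y"]
        by (simp add: B_def algebra_simps scale_left_distrib)
      finally show ?thesis .
    qed
    have "q' (u + v) - B v t' \<le> q' u" if "t' \<ge> 0" for t'
      unfolding q'_def[of u] using *[OF _ that] by (intro cINF_greatest) (auto simp: diff_le_eq)
    then have "q' (u + v) - q' u \<le> q' v"
      unfolding q'_def[of v] by (intro cINF_greatest) (auto simp: algebra_simps)
    then show "q' (u + v) \<le> q' u + q' v" by simp
  next
    fix r :: real and x assume r: "r > 0"
    have "q' (s r x) / r \<le> q' x"
      unfolding q'_def[of x]
    proof (rule cINF_greatest)
      fix t :: real assume t: "t \<in> {0..}"
      have "q' (s r x) \<le> B (s r x) (r * t)"
        using le t r by simp
      also have "\<dots> = r * B x t"
        using pos[of r "x + s t y"] r by (simp add: B_def scale_right_distrib algebra_simps)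
      finally show "q' (s r x) / r \<le> B x t"
        using r by (simp add: field_simps)
    qed simp
    then show "q' (s r x) \<le> r * q' x"
      using r by (simp add: field_simps)
  qed
qed

text \<open>A minimal sublinear functional coincides with its own reduction, hence is odd, hence linear.\<close>

theorem Hahn_Banach_real:
  assumes p: "sublinear s p"
  obtains q where "\<And>x y. q (x + y) = q x + q y" "\<And>r x. q (s r x) = r * q x"
    "\<And>x. q x \<le> p x" "q v = p v"
proof -
  \<comment> \<open>Reducing \<open>p\<close> at \<open>v\<close> beforehand forces
    \<open>q (- v) \<le> - p v\<close> for every \<open>q\<close> below \<open>p1\<close>; once
    \<open>q\<close> is odd, this is \<open>q v \<ge> p v\<close>.\<close>
  obtain p1 where p1: "sublinear s p1" "p1 \<le> p" "p1 (- v) = - p v"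
    using sublinear_reduce[OF p] .
  define A where "A = {q. sublinear s q \<and> q \<le> p1}"
  \<comment> \<open>The order is reversed, so the maximal element given by Zorn's lemma is a minimal
    sublinear functional.\<close>
  have "\<exists>q\<in>A. \<forall>r\<in>A. q \<ge> r \<longrightarrow> r = q"
  proof (rule predicate_Zorn)
    show "partial_order_on A (relation_of (\<ge>) A)"
      by (rule partial_order_on_relation_ofI) auto
    fix C assume C: "C \<in> Chains (relation_of (\<ge>) A)"
    show "\<exists>u\<in>A. \<forall>q\<in>C. q \<ge> u"
    proof (cases "C = {}")
      case True
      then show ?thesis using p1 by (auto simp: A_def)
    next
      case False
      have CA: "C \<subseteq> A" using C by (rule Chains_relation_of)
      have ch: "q \<le> r \<or> r \<le> q" if "q \<in> C" "r \<in> C" for q r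
        using C that by (auto simp: Chains_def relation_of_def)
      let ?u = "\<lambda>x. INF q\<in>C. q x"
      have u: "sublinear s ?u" "\<And>q. q \<in> C \<Longrightarrow> ?u \<le> q"
        using sublinear_INF_chain[OF p1(1) False, of] CA ch by (auto simp: A_def)
      moreover have "?u \<le> p1"
        using False CA u(2) unfolding A_def by (metis (mono_tags, lifting) ex_in_conv mem_Collect_eq order_trans subsetD)
      ultimately show ?thesis by (auto simp: A_def)
    qed
  qed
  then obtain q where q: "sublinear s q" "q \<le> p1" and
    min: "\<And>r. sublinear s r \<Longrightarrow> r \<le> q \<Longrightarrow> r = q"
    unfolding A_def using order_trans by blast
  have odd: "q (- y) = - q y" for y
    using sublinear_reduce[OF q(1), of y] min by metis
  have sub: "q (u + w) \<le> q u + q w" for u w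
    using q unfolding sublinear_def by blast
  show ?thesis
  proof
    show "q (x + y) = q x + q y" for x y
      using sub[of x y] sub[of "x + y" "- y"] odd[of y] by simp
    show "q x \<le> p x" for x
      using q(2) p1(2) by (meson le_funD order_trans)
    then have "q v \<le> p v" .
    moreover have "q (- v) \<le> - p v"
      using q(2) p1(3) by (metis le_funD)
    ultimately show "q v = p v" using odd[of v] by simp
    show "q (s r x) = r * q x" for r x
    proof (cases r "0::real" rule: linorder_cases)
      case less
      then have "q (- s r x) = - (r * q x)"
        using sublinear_scale[OF q(1), of "- r" x] by simp
      then show ?thesis using odd[of "s r x"] by simp
    qed (use sublinear_scale[OF q(1)] sublinear_zero[OF q(1)] in auto)
  qed
qed

end

section \<open>Scalars: transfer of facts from the complex numbers along the isometric
  embedding\<close>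

lemma real_or_complex_embedding:
  obtains \<phi> :: "'k::real_or_complex \<Rightarrow> complex"
  where "\<And>x y. \<phi> (x + y) = \<phi> x + \<phi> y" "\<And>x y. \<phi> (x * y) = \<phi> x * \<phi> y"
    "\<And>x. norm (\<phi> x) = norm x" "\<And>r. \<phi> (of_real r) = of_real r"
    "range \<phi> = \<real> \<or> range \<phi> = UNIV"
proof -
  obtain \<phi> :: "'k \<Rightarrow> complex"
    where add: "\<And>x y. \<phi> (x + y) = \<phi> x + \<phi> y" and mult: "\<And>x y. \<phi> (x * y) = \<phi> x * \<phi> y"
      and norm: "\<And>x. norm (\<phi> x) = norm x" and range: "range \<phi> = \<real> \<or> range \<phi> = UNIV"
    using isometric_real_or_complex[where 'a='k] by auto
  have "\<phi> 1 * \<phi> 1 = \<phi> 1" "\<phi> 1 \<noteq> 0"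
    using mult[of 1 1] norm[of 1] by auto
  then have one: "\<phi> 1 = 1" by simp
  have "\<phi> (of_real r) = of_real r" for r
  proof -
    have "\<phi> (of_real (r - 1)) + \<phi> 1 = \<phi> (of_real r)"
      unfolding add[symmetric] by simp
    then have "\<phi> (of_real r) - 1 = \<phi> (of_real (r - 1))"
      using one by (simp add: algebra_simps)
    \<comment> \<open>The distances of a complex number to 0 and to 1 determine its real part:
      subtracting the two equations gives real part \<open>r\<close>, and then the imaginary part is
      0.\<close>
    then have "norm (\<phi> (of_real r) - 1) ^ 2 = (r - 1)^2" "norm (\<phi> (of_real r)) ^ 2 = r^2"
      using norm by (simp_all only: norm_of_real power2_abs)
    then show ?thesis
      unfolding cmod_power2 by (auto simp: complex_eq_iff power2_eq_square algebra_simps)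
  qed
  with add mult norm range show thesis using that by blast
qed

text \<open>Gives the scalar type its own imaginary unit in the complex case, as the
  complexification in the Hahn-Banach theorem needs one. An isometric embedding is injective, so
  identities can be checked after applying it.\<close>

lemma real_or_complex_cases:
  obtains (real) "range (of_real :: real \<Rightarrow> 'k::real_or_complex) = UNIV"
  | (complex) i :: "'k::real_or_complex" where "i * i = -1" "\<And>x. \<exists>a b. x = of_real a + i * of_real b"
      "\<And>a b. norm (of_real a + i * of_real b) = cmod (Complex a b)"
proof -
  obtain \<phi> :: "'k::real_or_complex \<Rightarrow> complex"
    where \<phi>: "\<And>x y. \<phi> (x + y) = \<phi> x + \<phi> y" "\<And>x y. \<phi> (x * y) = \<phi> x * \<phi> y"
    "\<And>x. norm (\<phi> x) = norm x" "\<And>r. \<phi> (of_real r) = of_real r"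
    "range \<phi> = \<real> \<or> range \<phi> = UNIV"
    using real_or_complex_embedding by metis
  have inj: "x = y" if "\<phi> x = \<phi> y" for x y
  proof -
    have "\<phi> (x - y) + \<phi> y = \<phi> x" unfolding \<phi>(1)[symmetric] by simp
    then have "norm (\<phi> (x - y)) = 0" using that by simp
    then show ?thesis using \<phi>(3) by simp
  qed
  from \<phi>(5) show thesis
  proof
    assume r: "range \<phi> = \<real>"
    have "x \<in> range of_real" for x :: 'k
    proof -
      have "\<phi> x \<in> \<real>" using r by blast
      then obtain r where "\<phi> x = of_real r" by (auto elim: Reals_cases)
      then have "\<phi> x = \<phi> (of_real r)" using \<phi>(4) by simp
      then show ?thesis using inj by blast
    qed
    then show thesis using real by blast
  next
    assume "range \<phi> = UNIV"
    then obtain i where i: "\<phi> i = \<i>" by (metis surjD)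
    have C: "\<phi> (of_real a + i * of_real b) = Complex a b" for a b
      by (simp add: \<phi> i complex_eq_iff)
    show thesis
    proof (rule complex)
      have "\<phi> (-1) = -1" using \<phi>(4)[of "-1"] by simp
      then show "i * i = -1" using inj[of "i * i" "-1"] \<phi>(2) i by simp
      show "\<exists>a b. x = of_real a + i * of_real b" for x
      proof -
        have "\<phi> x = \<phi> (of_real (Re (\<phi> x)) + i * of_real (Im (\<phi> x)))"
          by (simp add: C)
        then show ?thesis using inj by blast
      qed
      show "norm (of_real a + i * of_real b) = cmod (Complex a b)" for a b
        using \<phi>(3) C by metis
    qed
  qed
qed

text \<open>Provides the coefficients that make a dense family of linear combinations
  countable.\<close>

lemma countable_dense_scalars:
  obtains R :: "'k::real_or_complex set"
  where "countable R" "\<And>x e. e > 0 \<Longrightarrow> \<exists>r\<in>R. norm (x - r) < e"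
proof -
  obtain \<phi> :: "'k::real_or_complex \<Rightarrow> complex"
    where \<phi>: "\<And>x y. \<phi> (x + y) = \<phi> x + \<phi> y" "\<And>x. norm (\<phi> x) = norm x"
    using real_or_complex_embedding by metis
  have diff: "norm (x - y) = norm (\<phi> x - \<phi> y)" for x y
    using \<phi>(1)[of "x - y" y] \<phi>(2)[of "x - y"] by simp
  obtain T where T: "countable T" "T \<subseteq> range \<phi>" "range \<phi> \<subseteq> closure T"
    using separable[of "range \<phi>"] by metis
  show thesis
  proof
    show "countable (inv \<phi> ` T)" using T by blast
    fix x :: 'k and e :: real assume "e > 0"
    then obtain t where t: "t \<in> T" "dist t (\<phi> x) < e"
      using T(3) by (meson closure_approachable rangeI subsetD)
    moreover have "\<phi> (inv \<phi> t) = t" using T(2) t(1) by (meson f_inv_into_f subsetD)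
    ultimately have "norm (x - inv \<phi> t) < e"
      by (simp add: diff dist_norm norm_minus_commute)
    with t show "\<exists>r\<in>inv \<phi> ` T. norm (x - r) < e" by blast
  qed
qed

text \<open>Bolzano-Weierstrass pulled back along an isometry. The Cauchy property transfers
  directly, without locating a limit in the range, and it already makes consecutive differences tend
  to 0.\<close>

lemma bounded_scalars_Cauchy_subseq:
  fixes X :: "nat \<Rightarrow> 'k::real_or_complex"
  assumes "\<And>n. norm (X n) \<le> C"
  obtains r where "strict_mono (r :: nat \<Rightarrow> nat)" "Cauchy (X \<circ> r)"
proof -
  obtain \<phi> :: "'k::real_or_complex \<Rightarrow> complex"
    where \<phi>: "\<And>x y. \<phi> (x + y) = \<phi> x + \<phi> y" "\<And>x. norm (\<phi> x) = norm x"
    using real_or_complex_embedding by metis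
  have diff: "norm (x - y) = norm (\<phi> x - \<phi> y)" for x y
    using \<phi>(1)[of "x - y" y] \<phi>(2)[of "x - y"] by simp
  have "bounded (range (\<phi> \<circ> X))"
    using assms \<phi>(2) unfolding bounded_iff by auto
  then obtain l r where r: "strict_mono (r :: nat \<Rightarrow> nat)" "((\<phi> \<circ> X) \<circ> r) \<longlonglongrightarrow> l"
    using bounded_imp_convergent_subsequence by metis
  then have "Cauchy ((\<phi> \<circ> X) \<circ> r)"
    using LIMSEQ_imp_Cauchy by blast
  then have "Cauchy (X \<circ> r)"
    unfolding Cauchy_def dist_norm diff by simp
  with r show thesis using that by blast
qed

text \<open>Seminorms are the right generality because the Hahn-Banach theorem is applied to the
  distance from a subspace and to an extension of the dual norm to all functions; both can vanish at
  nonzero vectors.\<close>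

locale seminormed_vs = vector_space scale
  for scale :: "'k::real_or_complex \<Rightarrow> 'a::ab_group_add \<Rightarrow> 'a" +
  fixes p :: "'a \<Rightarrow> real"
  assumes p_triangle: "p (x + y) \<le> p x + p y"
    and p_scale: "p (scale c x) = norm c * p x"

sublocale normed_vs \<subseteq> seminormed_vs scale nrm
  by unfold_locales (rule nrm_triangle nrm_scale)+

context seminormed_vs
begin

lemma p_zero: "p 0 = 0"
  using p_scale[of 0 0] by simp

lemma p_minus: "p (- x) = p x"
  using p_scale[of "- 1" x] by simp

lemma p_nonneg: "0 \<le> p x"
  using p_triangle[of x "- x"] p_zero p_minus[of x] by simp

theorem Hahn_Banach:
  obtains f :: "'a \<Rightarrow> 'k"
  where "\<And>x y. f (x + y) = f x + f y" "\<And>c x. f (scale c x) = c * f x"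
    "\<And>x. norm (f x) \<le> p x" "norm (f v) = p v"
proof -
  have vs: "vector_space (\<lambda>r. scale (of_real r))"
    by unfold_locales (auto simp: scale_right_distrib scale_left_distrib)
  have "sublinear (\<lambda>r. scale (of_real r)) p"
    unfolding sublinear_def by (simp add: p_triangle p_scale)
  then obtain q where q: "\<And>x y. q (x + y) = q x + q y" "\<And>r x. q (scale (of_real r) x) = r * q x"
    "\<And>x. q x \<le> p x" "q v = p v"
    using Hahn_Banach_real[OF vs] by metis
  have q_minus: "q (- x) = - q x" for x
    using q(2)[of "-1" x] by simp
  show thesis
  proof (cases rule: real_or_complex_cases[where 'k='k])
    case real
    then have of_real: "\<exists>r. c = of_real r" for c :: 'k by (metis UNIV_I imageE)
    show thesis
    proof (rule that)
      show "of_real (q (scale c x)) = c * (of_real (q x) :: 'k)" for c x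
        using of_real[of c] by (auto simp: q(2))
      show "norm (of_real (q x) :: 'k) \<le> p x" for x
        using q(3)[of x] q(3)[of "- x"] by (simp add: p_minus q_minus)
      show "norm (of_real (q v) :: 'k) = p v"
        by (simp add: q p_nonneg)
    qed (simp add: q)
  next
    case (complex i)
    \<comment> \<open>The usual complexification: \<open>q\<close> is the real part of
      \<open>f\<close>, and the second term makes \<open>f\<close> commute with multiplication by
      \<open>i\<close>.\<close>
    define f where "f x = of_real (q x) - i * of_real (q (scale i x))" for x
    have add: "f (x + y) = f x + f y" for x y
      by (simp add: f_def q(1) scale_right_distrib algebra_simps)
    have f_of_real: "f (scale (of_real r) x) = of_real r * f x" for r x
    proof -
      have "scale i (scale (of_real r) x) = scale (of_real r) (scale i x)"
        by (simp add: mult.commute)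
      then have "q (scale i (scale (of_real r) x)) = r * q (scale i x)"
        by (simp only: q(2))
      then show ?thesis
        by (simp add: f_def q(2) algebra_simps)
    qed
    have f_i: "f (scale i x) = i * f x" for x
    proof -
      have "q (scale i (scale i x)) = - q x"
        using complex(1) by (simp add: q_minus)
      moreover have "i * (i * y) = - y" for y
        by (simp add: complex(1) flip: mult.assoc)
      ultimately show ?thesis
        by (simp add: f_def right_diff_distrib)
    qed
    have f_scale: "f (scale c x) = c * f x" for c x
    proof -
      obtain a b where "c = of_real a + i * of_real b"
        using complex(2) by metis
      then have "f (scale c x) = f (scale (of_real a) x) + f (scale i (scale (of_real b) x))"
        by (simp add: scale_left_distrib flip: add)
      also have "\<dots> = of_real a * f x + i * (of_real b * f x)"
        by (simp only: f_i f_of_real)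
      finally show ?thesis using \<open>c = _\<close> by (simp add: algebra_simps)
    qed
    have norm_f: "norm (f x) = cmod (Complex (q x) (- q (scale i x)))" for x
      using complex(3)[of "q x" "- q (scale i x)"] by (simp add: f_def)
    have le: "norm (f x) \<le> p x" for x
    proof (cases "f x = 0")
      case False
      \<comment> \<open>Multiplication by the unit scalar \<open>u\<close> rotates
        \<open>f x\<close> onto \<open>norm (f x)\<close>, where the real part \<open>q\<close>
        carries everything and the bound on \<open>q\<close> applies.\<close>
      define u where "u = of_real (norm (f x)) / f x"
      have u: "norm u = 1" using False by (simp add: u_def norm_divide)
      have "f (scale u x) = of_real (norm (f x))"
        using False by (simp add: f_scale u_def)
      then have "of_real (q (scale u x) - norm (f x)) + i * of_real (- q (scale i (scale u x))) = 0"
        by (simp add: f_def[of "scale u x"] algebra_simps)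
      then have "cmod (Complex (q (scale u x) - norm (f x)) (- q (scale i (scale u x)))) = 0"
        by (metis complex(3) norm_zero)
      then have "q (scale u x) = norm (f x)"
        by (simp add: complex_eq_iff)
      then show ?thesis
        using q(3)[of "scale u x"] u by (simp add: p_scale)
    qed (simp add: p_nonneg)
    have "p v \<le> norm (f v)"
      using complex_Re_le_cmod[of "Complex (q v) (- q (scale i v))"] norm_f[of v] q(4) by simp
    then show thesis
      using that[of f] add f_scale le by (metis antisym)
  qed
qed

text \<open>The Hahn-Banach theorem for the seminorm \<open>d\<close>, the distance to
  \<open>W\<close>: being dominated by \<open>d\<close> means vanishing on \<open>W\<close>, and the
  value at \<open>v\<close> has modulus \<open>d v \<ge> e\<close>.\<close>

corollary Hahn_Banach_separation:
  assumes W: "subspace W" and e: "e > 0" and far: "\<And>w. w \<in> W \<Longrightarrow> e \<le> p (v - w)"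
  obtains f :: "'a \<Rightarrow> 'k"
  where "\<And>x y. f (x + y) = f x + f y" "\<And>c x. f (scale c x) = c * f x"
    "\<And>x. norm (f x) \<le> p x" "\<And>w. w \<in> W \<Longrightarrow> f w = 0" "f v \<noteq> 0"
proof -
  define d where "d x = (INF w\<in>W. p (x - w))" for x
  have ne: "W \<noteq> {}" using W subspace_0 by blast
  have d_le: "d x \<le> p (x - w)" if "w \<in> W" for x w
    unfolding d_def using that p_nonneg by (intro cINF_lower bdd_belowI2[of _ 0]) auto
  have d_ge: "c \<le> d x" if "\<And>w. w \<in> W \<Longrightarrow> c \<le> p (x - w)" for c x
    unfolding d_def using that by (intro cINF_greatest ne) auto
  have d_scale_le: "d (scale c x) \<le> norm c * d x" if "c \<noteq> 0" for c x
  proof -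
    have "d (scale c x) / norm c \<le> d x"
    proof (rule d_ge)
      fix w assume "w \<in> W"
      then have "d (scale c x) \<le> p (scale c x - scale c w)"
        using W by (intro d_le subspace_scale)
      also have "\<dots> = norm c * p (x - w)"
        by (simp add: p_scale flip: scale_right_diff_distrib)
      finally show "d (scale c x) / norm c \<le> p (x - w)"
        using that by (simp add: field_simps)
    qed
    then show ?thesis using that by (simp add: field_simps)
  qed
  interpret d: seminormed_vs scale d
  proof
    fix x y
    have *: "d (x + y) \<le> p (x - w) + p (y - w')" if "w \<in> W" "w' \<in> W" for w w'
    proof -
      have "d (x + y) \<le> p (x + y - (w + w'))"
        using W that by (intro d_le subspace_add)
      also have "\<dots> \<le> p (x - w) + p (y - w')"
        using p_triangle[of "x - w" "y - w'"] by (simp add: algebra_simps)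
      finally show ?thesis .
    qed
    have "d (x + y) - p (y - w') \<le> d x" if "w' \<in> W" for w'
      using *[OF _ that] by (intro d_ge) (simp add: diff_le_eq)
    then have "d (x + y) - d x \<le> d y"
      by (intro d_ge) (simp add: algebra_simps)
    then show "d (x + y) \<le> d x + d y" by simp
  next
    fix c x
    show "d (scale c x) = norm c * d x"
    proof (cases "c = 0")
      case True
      have "d 0 \<le> 0" using d_le[of 0 0] W subspace_0 p_zero by simp
      moreover have "0 \<le> d 0" using p_nonneg by (intro d_ge)
      ultimately show ?thesis using True by simp
    next
      case False
      then have "d (scale (1 / c) (scale c x)) \<le> norm (1 / c) * d (scale c x)"
        by (intro d_scale_le) simp
      then have "norm c * d x \<le> d (scale c x)"
        using False by (simp add: norm_divide field_simps)
      with d_scale_le[OF False, of x] show ?thesis by simp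
    qed
  qed
  obtain f :: "'a \<Rightarrow> 'k"
    where f: "\<And>x y. f (x + y) = f x + f y" "\<And>c x. f (scale c x) = c * f x"
      "\<And>x. norm (f x) \<le> d x" "norm (f v) = d v"
    using d.Hahn_Banach by metis
  show thesis
  proof
    show "norm (f x) \<le> p x" for x
      using f(3)[of x] d_le[of 0 x] W subspace_0 by simp
    show "f w = 0" if "w \<in> W" for w
      using order_trans[OF f(3)[of w] d_le[OF that, of w]] p_zero by simp
    have "e \<le> d v" using far by (rule d_ge)
    then show "f v \<noteq> 0" using f(4) e by auto
  qed (use f in auto)
qed

end

section \<open>Duality and reflexivity\<close>

text \<open>Makes the scalar-valued functions a vector space, so that the dual, a set of functions,
  becomes a subspace to which the Hahn-Banach theorem can be applied.\<close>

definition fun_scale :: "'k::times \<Rightarrow> ('a \<Rightarrow> 'k) \<Rightarrow> 'a \<Rightarrow> 'k"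
  where "fun_scale c f = (\<lambda>x. c * f x)"

interpretation fun_vs: vector_space "fun_scale :: 'k::field \<Rightarrow> ('a \<Rightarrow> 'k) \<Rightarrow> 'a \<Rightarrow> 'k"
  by unfold_locales (auto simp: fun_scale_def algebra_simps)

text \<open>Only the finitely many terms before \<open>N\<close> can exceed \<open>b\<close>. In
  contrapositive form it shows that a supremum is attained, once for the coordinate functionals of
  an operator and once for the coordinates of a null sequence.\<close>

lemma bounded_above_strict_sup:
  fixes a :: "nat \<Rightarrow> real"
  assumes "\<And>n. a n < L" "b < L" "\<And>n. n \<ge> N \<Longrightarrow> a n \<le> b"
  obtains C where "C < L" "\<And>n. a n \<le> C"
proof
  let ?A = "insert b (a ` {..<N})"
  show "Max ?A < L" using assms by auto
  show "a n \<le> Max ?A" for n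
  proof (cases "n < N")
    case False
    then have "a n \<le> b" using assms by simp
    also have "b \<le> Max ?A" by (intro Max_ge) auto
    finally show ?thesis .
  qed (intro Max_ge, auto)
qed

context normed_vs
begin

lemma nrm_zero: "nrm 0 = 0"
  by (simp add: nrm_eq_0)

lemma operator_norm_le:
  assumes "\<And>x. nrm x \<le> 1 \<Longrightarrow> nF (T x) \<le> C"
  shows "operator_norm nrm nF T \<le> C"
  unfolding operator_norm_def
proof (rule cSUP_least)
  show "{x. nrm x \<le> 1} \<noteq> {}" using nrm_zero by (auto intro!: exI[of _ 0])
qed (use assms in auto)

lemma le_operator_norm:
  assumes "\<And>x. nF (T x) \<le> C * nrm x" "nrm x \<le> 1"
  shows "nF (T x) \<le> operator_norm nrm nF T"
  unfolding operator_norm_def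
proof (rule cSUP_upper)
  show "bdd_above ((\<lambda>x. nF (T x)) ` {x. nrm x \<le> 1})"
  proof (rule bdd_aboveI2)
    fix x assume "x \<in> {x. nrm x \<le> 1}"
    then have "C * nrm x \<le> \<bar>C\<bar> * 1"
      by (intro mult_mono) (auto simp: nrm_nonneg)
    then show "nF (T x) \<le> \<bar>C\<bar>" using assms(1)[of x] by simp
  qed
qed (use assms in auto)

lemma dual_iff:
  "f \<in> dual scale nrm \<longleftrightarrow> (\<forall>x y. f (x + y) = f x + f y) \<and> (\<forall>c x. f (scale c x) = c * f x) \<and>
     (\<exists>C. \<forall>x. norm (f x) \<le> C * nrm x)"
  unfolding dual_def bounded_operator_def
  using vector_space_axioms vector_space_over_itself.vector_space_axioms
  by (auto simp: Vector_Spaces.linear_iff)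

lemma dualI:
  assumes "\<And>x y. f (x + y) = f x + f y" "\<And>c x. f (scale c x) = c * f x"
    "\<And>x. norm (f x) \<le> C * nrm x"
  shows "f \<in> dual scale nrm"
  using assms dual_iff by blast

lemma dual_add: "f \<in> dual scale nrm \<Longrightarrow> f (x + y) = f x + f y"
  and dual_scale: "f \<in> dual scale nrm \<Longrightarrow> f (scale c x) = c * f x"
  by (auto simp: dual_iff)

lemma dual_zero: "f \<in> dual scale nrm \<Longrightarrow> f 0 = 0"
  using dual_scale[of f 0 0] by simp

lemma dual_diff: "f \<in> dual scale nrm \<Longrightarrow> f (x - y) = f x - f y"
  using dual_add[of f "x - y" y] by simp

lemma dual_le:
  assumes "f \<in> dual scale nrm"
  shows "nrm x \<le> 1 \<Longrightarrow> norm (f x) \<le> operator_norm nrm norm f"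
    and "norm (f x) \<le> operator_norm nrm norm f * nrm x"
proof -
  obtain C where C: "\<And>x. norm (f x) \<le> C * nrm x" using assms dual_iff by blast
  show *: "norm (f x) \<le> operator_norm nrm norm f" if "nrm x \<le> 1" for x
    using le_operator_norm[of norm, OF C that] .
  show "norm (f x) \<le> operator_norm nrm norm f * nrm x"
  proof (cases "x = 0")
    case False
    then have pos: "nrm x > 0" using nrm_nonneg[of x] nrm_eq_0[of x] by linarith
    have "norm (f (scale (of_real (1 / nrm x)) x)) \<le> operator_norm nrm norm f"
      using pos by (intro *) (simp add: nrm_scale norm_divide)
    then show ?thesis
      using assms pos by (simp add: dual_scale norm_mult norm_divide field_simps)
  qed (simp add: nrm_zero dual_zero[OF assms])
qed

lemma operator_norm_dual_nonneg: "f \<in> dual scale nrm \<Longrightarrow> 0 \<le> operator_norm nrm norm f"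
  using dual_le(1)[of f 0] dual_zero[of f] nrm_zero by simp

lemma ex_norming_functional:
  obtains f where "f \<in> dual scale nrm" "\<And>x. norm (f x) \<le> nrm x" "norm (f v) = nrm v"
proof -
  obtain f where f: "\<And>x y. f (x + y) = f x + f y" "\<And>c x. f (scale c x) = c * f x"
    "\<And>x. norm (f x) \<le> nrm x" "norm (f v) = nrm v"
    using Hahn_Banach by metis
  moreover have "f \<in> dual scale nrm"
    using f dualI[of f 1] by simp
  ultimately show thesis using that by blast
qed

text \<open>Some vector of the unit ball reaches more than half of a positive norm, whence the
  factor 2; for norm 0 the vector 0 serves. A countable family of functionals is thus controlled by
  countably many vectors.\<close>

lemma ex_almost_norming_vector:
  assumes "f \<in> dual scale nrm"
  obtains d where "nrm d \<le> 1" "\<And>x. norm (f x) \<le> 2 * norm (f d) * nrm x"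
proof (cases "operator_norm nrm norm f \<le> 0")
  case True
  have "norm (f x) \<le> 2 * norm (f 0) * nrm x" for x
    using order_trans[OF dual_le(2)[OF assms, of x] mult_right_mono[OF True nrm_nonneg[of x]]]
      dual_zero[OF assms] by simp
  then show thesis using that[of 0] nrm_zero by simp
next
  case False
  then have "\<not> operator_norm nrm norm f \<le> operator_norm nrm norm f / 2" by simp
  then obtain d where d: "nrm d \<le> 1" "\<not> norm (f d) \<le> operator_norm nrm norm f / 2"
    using operator_norm_le[of norm f] by blast
  have "norm (f x) \<le> 2 * norm (f d) * nrm x" for x
    using dual_le(2)[OF assms, of x] d(2)
      mult_right_mono[OF _ nrm_nonneg[of x], of "operator_norm nrm norm f" "2 * norm (f d)"] by linarith
  with d show thesis using that by blast
qed

lemma dual_lincomb: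
  assumes "f \<in> dual scale nrm" "g \<in> dual scale nrm"
  shows "(\<lambda>x. a * f x + b * g x) \<in> dual scale nrm"
proof (rule dualI)
  fix x
  have "norm (a * f x + b * g x) \<le> norm a * (operator_norm nrm norm f * nrm x) + norm b * (operator_norm nrm norm g * nrm x)"
    using assms by (intro norm_triangle_le add_mono) (auto simp: norm_mult intro!: mult_left_mono dual_le)
  then show "norm (a * f x + b * g x)
      \<le> (norm a * operator_norm nrm norm f + norm b * operator_norm nrm norm g) * nrm x"
    by (simp add: algebra_simps)
qed (use assms in \<open>simp_all add: dual_add dual_scale algebra_simps\<close>)

lemma subspace_dual: "fun_vs.subspace (dual scale nrm)"
proof -
  have "(\<lambda>x. 0) \<in> dual scale nrm" by (rule dualI[of _ 0]) auto
  then show ?thesis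
    unfolding fun_vs.subspace_def
    using dual_lincomb[of _ _ 1 1] dual_lincomb[of _ _ _ 0]
    by (auto simp: zero_fun_def plus_fun_def fun_scale_def)
qed

text \<open>
  The dual is a subset of a function type; composing its norm with a linear projection onto it
  gives a seminorm on the whole type, to which the Hahn-Banach theorem applies.
\<close>

lemma dual_seminorm:
  obtains q where "seminormed_vs fun_scale q"
    "\<And>f. f \<in> dual scale nrm \<Longrightarrow> q f = operator_norm nrm norm f"
proof -
  interpret fp: vector_space_pair "fun_scale :: 'k \<Rightarrow> ('a \<Rightarrow> 'k) \<Rightarrow> _" "fun_scale :: 'k \<Rightarrow> ('a \<Rightarrow> 'k) \<Rightarrow> _" ..
  \<comment> \<open>A linear left inverse of the identity on the dual, with range in the dual, is an
    algebraic projection onto it.\<close>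
  have "Vector_Spaces.linear (fun_scale :: 'k \<Rightarrow> ('a \<Rightarrow> 'k) \<Rightarrow> _) fun_scale id"
    using fun_vs.vector_space_axioms by (simp add: Vector_Spaces.linear_iff)
  then obtain P where P: "range P \<subseteq> dual scale nrm" "Vector_Spaces.linear fun_scale fun_scale P"
    "\<And>f. f \<in> dual scale nrm \<Longrightarrow> P f = f"
    using fp.linear_exists_left_inverse_on[OF _ subspace_dual, of id] by auto
  have Pd: "P f \<in> dual scale nrm" for f using P by blast
  show thesis
  proof
    show "seminormed_vs fun_scale (\<lambda>f. operator_norm nrm norm (P f))"
    proof
      fix f g :: "'a \<Rightarrow> 'k" and c
      have "P (f + g) = P f + P g" "P (fun_scale c f) = fun_scale c (P f)"
        using P(2) by (auto simp: Vector_Spaces.linear_iff)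
      then have P_add: "P (f + g) x = P f x + P g x"
        and P_scale: "P (fun_scale c f) x = c * P f x" for x
        by (auto simp: fun_scale_def)
      show "operator_norm nrm norm (P (f + g))
          \<le> operator_norm nrm norm (P f) + operator_norm nrm norm (P g)"
        by (rule operator_norm_le) (auto simp: P_add intro!: norm_triangle_le add_mono dual_le Pd)
      have le: "operator_norm nrm norm (P (fun_scale c f)) \<le> norm c * operator_norm nrm norm (P f)"
        by (rule operator_norm_le)
          (auto simp: P_scale norm_mult intro!: mult_left_mono dual_le Pd)
      show "operator_norm nrm norm (P (fun_scale c f)) = norm c * operator_norm nrm norm (P f)"
      proof (cases "c = 0")
        case True
        then show ?thesis using le operator_norm_dual_nonneg[OF Pd, of "fun_scale c f"] by simp
      next
        case False
        have "operator_norm nrm norm (P f) \<le> operator_norm nrm norm (P (fun_scale c f)) / norm c"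
        proof (rule operator_norm_le)
          fix x assume "nrm x \<le> 1"
          then have "norm (P (fun_scale c f) x) \<le> operator_norm nrm norm (P (fun_scale c f))"
            by (intro dual_le Pd)
          then show "norm (P f x) \<le> operator_norm nrm norm (P (fun_scale c f)) / norm c"
            using False by (simp add: P_scale norm_mult field_simps)
        qed
        with le False show ?thesis by (simp add: field_simps)
      qed
    qed
  qed (simp add: P)
qed

text \<open>Reflexivity yields the point \<open>x\<close>; that it lies in the unit ball follows by
  evaluating \<open>\<Phi>\<close> at a functional that norms \<open>x\<close>.\<close>

lemma reflexive_evaluation:
  assumes "reflexive scale nrm"
    and "\<And>f g. \<Phi> (f + g) = \<Phi> f + \<Phi> g" "\<And>c f. \<Phi> (fun_scale c f) = c * \<Phi> f"
    and "\<And>f. f \<in> dual scale nrm \<Longrightarrow> norm (\<Phi> f) \<le> operator_norm nrm norm f"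
  obtains x where "nrm x \<le> 1" "\<And>f. f \<in> dual scale nrm \<Longrightarrow> \<Phi> f = f x"
proof -
  have "\<Phi> \<in> bidual scale nrm"
    unfolding bidual_def using assms(2-4)
    by (auto simp: plus_fun_def fun_scale_def intro!: exI[of _ 1])
  then obtain x where x: "\<And>f. f \<in> dual scale nrm \<Longrightarrow> \<Phi> f = f x"
    using assms(1) unfolding reflexive_def by blast
  obtain f where f: "f \<in> dual scale nrm" "\<And>y. norm (f y) \<le> nrm y" "norm (f x) = nrm x"
    using ex_norming_functional by metis
  have "norm (f x) \<le> operator_norm nrm norm f"
    using assms(4) x f(1) by metis
  also have "\<dots> \<le> 1"
    using f(2) order_trans by (blast intro: operator_norm_le)
  finally show thesis using that x f(3) by simp
qed

text \<open>The easy direction of James' theorem: a functional on the dual that norms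
  \<open>f\<close> is evaluation at a point of the unit ball.\<close>

lemma reflexive_attains_norm:
  assumes "reflexive scale nrm" "f \<in> dual scale nrm"
  obtains x where "nrm x \<le> 1" "norm (f x) = operator_norm nrm norm f"
proof -
  obtain q where q: "seminormed_vs fun_scale q"
    "\<And>f. f \<in> dual scale nrm \<Longrightarrow> q f = operator_norm nrm norm f"
    using dual_seminorm by blast
  obtain \<Phi> where \<Phi>: "\<And>f g. \<Phi> (f + g) = \<Phi> f + \<Phi> g" "\<And>c f. \<Phi> (fun_scale c f) = c * \<Phi> f"
    "\<And>f. norm (\<Phi> f) \<le> q f" "norm (\<Phi> f) = q f"
    using seminormed_vs.Hahn_Banach[OF q(1), of f] by metis
  obtain x where "nrm x \<le> 1" "\<And>f. f \<in> dual scale nrm \<Longrightarrow> \<Phi> f = f x"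
    using reflexive_evaluation[OF assms(1) \<Phi>(1,2)] \<Phi>(3) q(2) by metis
  then show thesis using that \<Phi>(4) q(2) assms(2) by metis
qed

text \<open>The functional on the dual that separates \<open>v\<close> from \<open>G\<close> is
  evaluation at a point. In other words, norm closed subspaces of the dual of a reflexive space are
  weak-star closed.\<close>

lemma reflexive_separation:
  assumes refl: "reflexive scale nrm" and v: "v \<in> dual scale nrm"
    and G: "fun_vs.subspace G" "G \<subseteq> dual scale nrm"
    and e: "e > 0" and far: "\<And>g. g \<in> G \<Longrightarrow> e \<le> operator_norm nrm norm (v - g)"
  obtains x where "\<And>g. g \<in> G \<Longrightarrow> g x = 0" "v x \<noteq> 0"
proof -
  obtain q where q: "seminormed_vs fun_scale q"
    "\<And>f. f \<in> dual scale nrm \<Longrightarrow> q f = operator_norm nrm norm f"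
    using dual_seminorm by blast
  have "v - g \<in> dual scale nrm" if "g \<in> G" for g
    using that v G subspace_dual by (blast intro: fun_vs.subspace_diff)
  then have "e \<le> q (v - g)" if "g \<in> G" for g
    using that far q(2) by simp
  then obtain \<Phi> where \<Phi>: "\<And>f g. \<Phi> (f + g) = \<Phi> f + \<Phi> g" "\<And>c f. \<Phi> (fun_scale c f) = c * \<Phi> f"
    "\<And>f. norm (\<Phi> f) \<le> q f" "\<And>g. g \<in> G \<Longrightarrow> \<Phi> g = 0" "\<Phi> v \<noteq> 0"
    using seminormed_vs.Hahn_Banach_separation[OF q(1) G(1) e, of v] by metis
  obtain x where "nrm x \<le> 1" "\<And>f. f \<in> dual scale nrm \<Longrightarrow> \<Phi> f = f x"
    using reflexive_evaluation[OF refl \<Phi>(1,2)] \<Phi>(3) q(2) by metis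
  then show thesis using that \<Phi>(4,5) v G(2) by (metis subsetD)
qed

end

section \<open>Compact perturbations\<close>

context normed_vs
begin

text \<open>The image of the unit ball has a finite \<open>e / 2\<close>-net. Its members are
  finitely many null sequences, so one index works for all of them and hence uniformly on the
  image.\<close>

lemma compact_into_c0_tail:
  fixes K :: "'a \<Rightarrow> 'k c0"
  assumes K: "compact_operator scale nrm c0_scale c0_norm K" and "e > 0"
  obtains N where "\<And>n x. n \<ge> N \<Longrightarrow> nrm x \<le> 1 \<Longrightarrow> norm (c0_seq (K x) n) < e"
proof -
  interpret M: Metric_space "UNIV :: 'k c0 set" "\<lambda>x y. c0_norm (x - y)"
    by (rule c0.Metric_space_nrm)
  let ?S = "K ` {x. nrm x \<le> 1}"
  have "compactin M.mtopology (M.mtopology closure_of ?S)"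
    using K by (simp add: compact_operator_def norm_topology_def)
  then have "M.mtotally_bounded ?S"
    using M.mtotally_bounded_subset[OF M.compactin_imp_mtotally_bounded] closure_of_subset[of ?S M.mtopology]
    by simp
  then obtain A where A: "finite A" "?S \<subseteq> (\<Union>y\<in>A. M.mball y (e / 2))"
    unfolding M.mtotally_bounded_def using \<open>e > 0\<close> by (meson half_gt_zero)
  have "\<exists>N. \<forall>n\<ge>N. norm (c0_seq y n) < e / 2" for y :: "'k c0"
    using LIMSEQ_D[OF c0_seq_tendsto, of "e / 2"] \<open>e > 0\<close> by simp
  then obtain N :: "'k c0 \<Rightarrow> nat" where N: "\<And>y n. n \<ge> N y \<Longrightarrow> norm (c0_seq y n) < e / 2"
    by metis
  show thesis
  proof
    fix n x assume n: "Max (N ` A) \<le> n" and x: "nrm x \<le> 1"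
    then obtain y where y: "y \<in> A" "c0_norm (y - K x) < e / 2"
      using A(2) by (auto simp: M.mball_def)
    have "norm (c0_seq y n) < e / 2"
      using y A n by (intro N) (meson Max_ge finite_imageI imageI order_trans)
    moreover have "norm (c0_seq y n - c0_seq (K x) n) < e / 2"
      using norm_c0_seq_le[of "y - K x" n] y(2) by (simp add: minus_c0.rep_eq)
    ultimately show "norm (c0_seq (K x) n) < e"
      using norm_triangle_ineq2[of "c0_seq (K x) n" "c0_seq y n"]
      by (simp add: norm_minus_commute)
  qed
qed

lemma c0_coordinate_dual:
  fixes T :: "'a \<Rightarrow> 'k c0"
  assumes "bounded_operator scale nrm c0_scale c0_norm T"
  shows "(\<lambda>x. c0_seq (T x) n) \<in> dual scale nrm"
proof -
  obtain C where C: "\<And>x. c0_norm (T x) \<le> C * nrm x"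
    using assms unfolding bounded_operator_def by blast
  show ?thesis
  proof (rule dualI)
    show "norm (c0_seq (T x) n) \<le> C * nrm x" for x
      using norm_c0_seq_le C order_trans by blast
  qed (use assms in \<open>auto simp: bounded_operator_def Vector_Spaces.linear_iff
    plus_c0.rep_eq c0_scale.rep_eq\<close>)
qed

text \<open>Compactness is defined through linearity and the image of the unit ball alone. That
  image has finite diameter and contains 0, which bounds \<open>K\<close>.\<close>

lemma compact_operator_bounded:
  fixes K :: "'a \<Rightarrow> 'k c0"
  assumes K: "compact_operator scale nrm c0_scale c0_norm K"
  shows "bounded_operator scale nrm c0_scale c0_norm K"
proof -
  interpret M: Metric_space "UNIV :: 'k c0 set" "\<lambda>x y. c0_norm (x - y)"
    by (rule c0.Metric_space_nrm)
  let ?S = "K ` {x. nrm x \<le> 1}"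
  have lin: "K (x + y) = K x + K y" "K (scale c x) = c0_scale c (K x)" for x y c
    using K by (auto simp: compact_operator_def Vector_Spaces.linear_iff)
  have "compactin M.mtopology (M.mtopology closure_of ?S)"
    using K by (simp add: compact_operator_def norm_topology_def)
  then have "M.mbounded ?S"
    using M.compactin_imp_mbounded M.mbounded_subset closure_of_subset[of ?S M.mtopology] by fastforce
  then obtain B where B: "\<And>x y. nrm x \<le> 1 \<Longrightarrow> nrm y \<le> 1 \<Longrightarrow> c0_norm (K x - K y) \<le> B"
    unfolding M.mbounded_alt by blast
  have K0: "K 0 = 0" using lin(2)[of 0 0] by simp
  have "c0_norm (K x) \<le> B * nrm x" for x
  proof (cases "x = 0")
    case True
    then show ?thesis by (simp add: K0 nrm_zero c0.nrm_zero)
  next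
    case False
    then have pos: "nrm x > 0" using nrm_nonneg[of x] nrm_eq_0[of x] by linarith
    then have "c0_norm (K (scale (of_real (1 / nrm x)) x)) \<le> B"
      using B[of "scale (of_real (1 / nrm x)) x" 0] by (simp add: K0 nrm_zero nrm_scale norm_divide)
    then show ?thesis
      using pos by (simp add: lin c0.nrm_scale norm_divide field_simps)
  qed
  then show ?thesis
    using K by (auto simp: bounded_operator_def compact_operator_def)
qed

lemma compact_perturbation_attains_norm:
  fixes T K :: "'a \<Rightarrow> 'k c0"
  assumes refl: "reflexive scale nrm"
    and T: "bounded_operator scale nrm c0_scale c0_norm T"
    and K: "compact_operator scale nrm c0_scale c0_norm K"
    and less: "operator_norm nrm c0_norm T < operator_norm nrm c0_norm (\<lambda>x. T x + K x)"
  shows "attains_norm nrm c0_norm (\<lambda>x. T x + K x)"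
proof -
  let ?S = "\<lambda>x. T x + K x"
  define L where "L = operator_norm nrm c0_norm ?S"
  define l where "l = operator_norm nrm c0_norm T"
  define s where "s n x = c0_seq (?S x) n" for n x
  note Kb = compact_operator_bounded[OF K]
  obtain CT CK where CT: "\<And>x. c0_norm (T x) \<le> CT * nrm x" and CK: "\<And>x. c0_norm (K x) \<le> CK * nrm x"
    using T Kb unfolding bounded_operator_def by blast
  have "c0_norm (?S x) \<le> (CT + CK) * nrm x" for x
    using c0.nrm_triangle[of "T x" "K x"] CT[of x] CK[of x] by (simp add: algebra_simps)
  then have S: "bounded_operator scale nrm c0_scale c0_norm ?S"
    and le_L: "nrm x \<le> 1 \<Longrightarrow> c0_norm (?S x) \<le> L" for x
    using T Kb le_operator_norm[of c0_norm ?S "CT + CK"]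
    by (auto simp: bounded_operator_def Vector_Spaces.linear_iff c0.scale_right_distrib L_def)
  have le_l: "nrm x \<le> 1 \<Longrightarrow> c0_norm (T x) \<le> l" for x
    unfolding l_def using le_operator_norm[of c0_norm T, OF CT] .
  have l0: "0 \<le> l" using le_l[of 0] c0.nrm_nonneg[of "T 0"] nrm_zero by linarith
  have "l < L" using less by (simp add: l_def L_def)
  have s_dual: "s n \<in> dual scale nrm" for n
    unfolding s_def using c0_coordinate_dual[OF S] .
  have s_le: "operator_norm nrm norm (s n) \<le> L" for n
    using le_L norm_c0_seq_le order_trans unfolding s_def by (blast intro: operator_norm_le)
  \<comment> \<open>Half of the gap between the two norms: beyond \<open>N\<close> the coordinate
    functionals have norm at most \<open>l + (L - l) / 2\<close>, still strictly below
    \<open>L\<close>.\<close>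
  obtain N where N: "\<And>n x. n \<ge> N \<Longrightarrow> nrm x \<le> 1 \<Longrightarrow> norm (c0_seq (K x) n) < (L - l) / 2"
    using compact_into_c0_tail[OF K, of "(L - l) / 2"] \<open>l < L\<close> by auto
  have tail: "operator_norm nrm norm (s n) \<le> (L + l) / 2" if "n \<ge> N" for n
  proof (rule operator_norm_le)
    fix x assume x: "nrm x \<le> 1"
    have "norm (s n x) \<le> norm (c0_seq (T x) n) + norm (c0_seq (K x) n)"
      by (simp add: s_def plus_c0.rep_eq norm_triangle_ineq)
    also have "\<dots> \<le> l + (L - l) / 2"
      using N[OF that x] le_l[OF x] norm_c0_seq_le[of "T x" n] by linarith
    finally show "norm (s n x) \<le> (L + l) / 2" by (simp add: field_simps)
  qed
  have "\<exists>n. operator_norm nrm norm (s n) = L"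
  proof (rule ccontr)
    assume "\<nexists>n. operator_norm nrm norm (s n) = L"
    then have lt: "operator_norm nrm norm (s n) < L" for n
      using s_le[of n] by (meson less_eq_real_def)
    have "(L + l) / 2 < L" using \<open>l < L\<close> by simp
    then obtain C where C: "C < L" "\<And>n. operator_norm nrm norm (s n) \<le> C"
      using bounded_above_strict_sup[of "\<lambda>n. operator_norm nrm norm (s n)", OF lt _ tail] by blast
    have "L \<le> C"
      unfolding L_def
    proof (intro operator_norm_le c0_norm_le)
      fix x n assume "nrm x \<le> 1"
      then show "norm (c0_seq (?S x) n) \<le> C"
        using dual_le(1)[OF s_dual] C(2) order_trans unfolding s_def by blast
    qed
    then show False using C(1) by simp
  qed
  then obtain n where n: "operator_norm nrm norm (s n) = L" ..
  obtain x where x: "nrm x \<le> 1" "norm (s n x) = L"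
    using reflexive_attains_norm[OF refl s_dual, of n] n by metis
  \<comment> \<open>So far \<open>x\<close> is only known to lie in the unit ball; since
    \<open>L > l \<ge> 0\<close>, this inequality puts it on the sphere.\<close>
  have "L \<le> L * nrm x"
    using dual_le(2)[OF s_dual, of n x] x(2) n by simp
  then have "nrm x = 1"
    using x(1) \<open>l < L\<close> l0 by simp
  moreover have "c0_norm (?S x) = L"
    using le_L[OF x(1)] x(2) norm_c0_seq_le[of "?S x" n] by (simp add: s_def)
  ultimately show ?thesis
    unfolding attains_norm_def L_def by blast
qed

end

section \<open>Pointwise null sequences of functionals\<close>

text \<open>Finite codimension of the common kernel, phrased without quotients: a finite-dimensional
  span already realises all value tuples. A new functional either is determined by the earlier ones,
  or is nonzero at some \<open>z\<close> where they vanish; a multiple of \<open>z\<close> then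
  corrects its value without disturbing theirs.\<close>

lemma (in vector_space) finite_codimension_kernel:
  fixes f :: "nat \<Rightarrow> 'b \<Rightarrow> 'a"
  assumes f: "\<And>i x y. i < n \<Longrightarrow> f i (x + y) = f i x + f i y"
    "\<And>i c x. i < n \<Longrightarrow> f i (scale c x) = c * f i x"
  shows "\<exists>B. finite B \<and> (\<forall>x. \<exists>b\<in>span B. \<forall>i<n. f i x = f i b)"
  using f
proof (induction n)
  case 0
  show ?case by (rule exI[of _ "{}"]) auto
next
  case (Suc n)
  then obtain B where B: "finite B" "\<And>x. \<exists>b\<in>span B. \<forall>i<n. f i x = f i b"
    by (metis less_SucI)
  have diff: "f i (x - y) = f i x - f i y" if "i < Suc n" for i x y
    using Suc.prems(1)[OF that, of "x - y" y] by simp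
  show ?case
  proof (cases "\<exists>z. (\<forall>i<n. f i z = 0) \<and> f n z \<noteq> 0")
    case False
    have "\<exists>b\<in>span B. \<forall>i<Suc n. f i x = f i b" for x
    proof -
      obtain b where b: "b \<in> span B" "\<forall>i<n. f i x = f i b" using B(2) by blast
      then have "\<forall>i<n. f i (x - b) = 0" using diff by simp
      with False have "f n (x - b) = 0" by blast
      then have "f n x = f n b" using diff by simp
      with b show ?thesis by (auto simp: less_Suc_eq)
    qed
    with B(1) show ?thesis by blast
  next
    case True
    then obtain z where z: "\<forall>i<n. f i z = 0" "f n z \<noteq> 0" by blast
    have "\<exists>b\<in>span (insert z B). \<forall>i<Suc n. f i x = f i b" for x
    proof -
      obtain b where b: "b \<in> span B" "\<forall>i<n. f i x = f i b" using B(2) by blast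
      let ?b = "b + scale ((f n x - f n b) / f n z) z"
      have "?b \<in> span (insert z B)"
        using b(1) span_mono[of B "insert z B"]
        by (intro span_add span_scale) (auto intro: span_base)
      moreover have "\<forall>i<Suc n. f i x = f i ?b"
        using b(2) z by (auto simp: less_Suc_eq Suc.prems)
      ultimately show ?thesis by blast
    qed
    with B(1) show ?thesis by (metis finite_insert)
  qed
qed

lemma (in vector_space) infinite_dimensional_common_kernel:
  fixes f :: "nat \<Rightarrow> 'b \<Rightarrow> 'a"
  assumes inf: "infinite_dimensional scale"
    and f: "\<And>i x y. i < n \<Longrightarrow> f i (x + y) = f i x + f i y"
    "\<And>i c x. i < n \<Longrightarrow> f i (scale c x) = c * f i x"
  obtains x where "x \<noteq> 0" "\<And>i. i < n \<Longrightarrow> f i x = 0"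
proof (rule ccontr)
  assume "\<not> thesis"
  with that have triv: "x = 0" if "\<forall>i<n. f i x = 0" for x using that by blast
  have diff: "f i (x - y) = f i x - f i y" if "i < n" for i x y
    using f(1)[OF that, of "x - y" y] by simp
  obtain B where B: "finite B" "\<And>x. \<exists>b\<in>span B. \<forall>i<n. f i x = f i b"
    using finite_codimension_kernel[of n f] f by metis
  have "x \<in> span B" for x
  proof -
    obtain b where b: "b \<in> span B" "\<forall>i<n. f i x = f i b" using B(2) by blast
    then have "x - b = 0" using diff by (intro triv) simp
    with b show ?thesis by simp
  qed
  then have "span B = UNIV" by blast
  obtain C where C: "C \<subseteq> B" "independent C" "B \<subseteq> span C"
    using maximal_independent_subset by blast
  then have "span C = UNIV"
    using \<open>span B = UNIV\<close> span_minimal[OF C(3) subspace_span] by blast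
  then have "finite_dimensional_vector_space scale C"
    using C B(1) finite_subset by unfold_locales auto
  then show False using inf unfolding infinite_dimensional_def by blast
qed

context normed_vs
begin

text \<open>Each \<open>x n\<close> is a unit vector in the common kernel of the earlier
  functionals, and \<open>f n\<close> norms it. Hence \<open>f n - f i\<close> has modulus 1 at
  \<open>x n\<close> for \<open>i < n\<close>, so differences of these functionals never become
  small in norm.\<close>

lemma triangular_system:
  assumes inf: "infinite_dimensional scale"
  obtains x :: "nat \<Rightarrow> 'a" and f :: "nat \<Rightarrow> 'a \<Rightarrow> 'k"
  where "\<And>n. nrm (x n) = 1" "\<And>n. f n \<in> dual scale nrm" "\<And>n y. norm (f n y) \<le> nrm y"
    "\<And>n. norm (f n (x n)) = 1" "\<And>n i. i < n \<Longrightarrow> f i (x n) = 0"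
proof -
  define P :: "(nat \<Rightarrow> 'a \<times> ('a \<Rightarrow> 'k)) \<Rightarrow> nat \<Rightarrow> 'a \<times> ('a \<Rightarrow> 'k) \<Rightarrow> bool" where
    "P F n r \<longleftrightarrow> (nrm (fst r) = 1 \<and> snd r \<in> dual scale nrm \<and> (\<forall>y. norm (snd r y) \<le> nrm y) \<and>
      norm (snd r (fst r)) = 1 \<and> (\<forall>i<n. snd (F i) (fst r) = 0))" for F n r
  have "\<exists>F. \<forall>n. P F n (F n)"
  proof (rule dependent_wf_choice[OF wf_less_than])
    fix F G :: "nat \<Rightarrow> 'a \<times> ('a \<Rightarrow> 'k)" and n r
    assume "\<And>i. (i, n) \<in> less_than \<Longrightarrow> F i = G i"
    then show "P F n r = P G n r" by (auto simp: P_def)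
  next
    fix n F assume F: "\<And>i. (i, n) \<in> less_than \<Longrightarrow> P F i (F i)"
    then have d: "snd (F i) \<in> dual scale nrm" if "i < n" for i
      using that by (auto simp: P_def)
    obtain x where x: "x \<noteq> 0" "\<And>i. i < n \<Longrightarrow> snd (F i) x = 0"
      using infinite_dimensional_common_kernel[OF inf, of n "\<lambda>i. snd (F i)"] d
      by (metis dual_add dual_scale)
    then have pos: "nrm x > 0" using nrm_nonneg[of x] nrm_eq_0[of x] by linarith
    let ?x = "scale (of_real (1 / nrm x)) x"
    have x1: "nrm ?x = 1" using pos by (simp add: nrm_scale norm_divide)
    obtain f where "f \<in> dual scale nrm" "\<And>y. norm (f y) \<le> nrm y" "norm (f ?x) = nrm ?x"
      using ex_norming_functional[of ?x] by blast
    then have "P F n (?x, f)"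
      using x1 x(2) d by (simp add: P_def dual_scale)
    then show "\<exists>r. P F n r" ..
  qed
  then obtain F where F: "\<And>n. P F n (F n)" by blast
  show thesis
    by (rule that[of "\<lambda>n. fst (F n)" "\<lambda>n. snd (F n)"]) (use F in \<open>auto simp: P_def\<close>)
qed

lemma subspace_lincombs:
  fixes f :: "nat \<Rightarrow> 'b \<Rightarrow> 'k"
  shows "fun_vs.subspace {\<lambda>x. \<Sum>i<n. c i * f i x | n c. True}" (is "fun_vs.subspace ?G")
  unfolding fun_vs.subspace_def
proof (intro conjI ballI allI)
  show "0 \<in> ?G"
    by (rule CollectI, rule exI[of _ 0]) (simp add: zero_fun_def)
  show "fun_scale a u \<in> ?G" if "u \<in> ?G" for a u
  proof -
    obtain n c where "u = (\<lambda>x. \<Sum>i<n. c i * f i x)" using \<open>u \<in> ?G\<close> by blast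
    then have "fun_scale a u = (\<lambda>x. \<Sum>i<n. (a * c i) * f i x)"
      by (simp add: fun_scale_def sum_distrib_left mult.assoc)
    then show ?thesis by (intro CollectI exI conjI TrueI)
  qed
  show "u + v \<in> ?G" if uv: "u \<in> ?G" "v \<in> ?G" for u v
  proof -
    obtain n c m d where *: "u = (\<lambda>x. \<Sum>i<n. c i * f i x)" "v = (\<lambda>x. \<Sum>i<m. d i * f i x)"
      using uv by blast
    let ?N = "max n m"
    let ?c = "\<lambda>i. if i < n then c i else 0" and ?d = "\<lambda>i. if i < m then d i else 0"
    have c: "(\<Sum>i<n. c i * f i x) = (\<Sum>i<?N. ?c i * f i x)" for x
      by (rule sum.mono_neutral_cong_left) auto
    have d: "(\<Sum>i<m. d i * f i x) = (\<Sum>i<?N. ?d i * f i x)" for x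
      by (rule sum.mono_neutral_cong_left) auto
    have "u + v = (\<lambda>x. \<Sum>i<?N. (?c i + ?d i) * f i x)"
      unfolding * plus_fun_def c d sum.distrib[symmetric] distrib_right[symmetric] ..
    then show ?thesis by (intro CollectI exI conjI TrueI)
  qed
qed

text \<open>
  By reflexivity a functional vanishing on the common kernel of the \<open>f i\<close> is a norm limit of
  their linear combinations, and such a limit is determined by its values on a countable set.
\<close>

lemma countable_complement_of_kernel:
  fixes f :: "nat \<Rightarrow> 'a \<Rightarrow> 'k"
  assumes refl: "reflexive scale nrm" and f: "\<And>i. f i \<in> dual scale nrm"
    and f_le: "\<And>i y. norm (f i y) \<le> nrm y"
  obtains D where "countable D"
    "\<And>x e. e > 0 \<Longrightarrow> \<exists>w\<in>span (D \<union> {x. \<forall>i. f i x = 0}). nrm (x - w) < e"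
proof -
  define comb where "comb n c x = (\<Sum>i<n. c i * f i x)" for n c x
  define G where "G = {\<lambda>x. \<Sum>i<n. c i * f i x | n c. True}"
  have G_eq: "G = {comb n c | n c. True}" unfolding G_def comb_def by simp
  obtain R :: "'k set" where R: "countable R" "\<And>x e. e > 0 \<Longrightarrow> \<exists>r\<in>R. norm (x - r) < e"
    using countable_dense_scalars by blast
  have comb_dual: "comb n c \<in> dual scale nrm" for n c
  proof (induction n)
    case 0
    then show ?case using fun_vs.subspace_0[OF subspace_dual]
      by (simp add: comb_def[abs_def] zero_fun_def)
  next
    case (Suc n)
    then show ?case using dual_lincomb[OF Suc f[of n], of 1 "c n"]
      by (simp add: comb_def[abs_def])
  qed
  have "\<exists>d. nrm d \<le> 1 \<and> (\<forall>x. norm (comb n c x) \<le> 2 * norm (comb n c d) * nrm x)" for n c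
    using ex_almost_norming_vector[OF comb_dual] by metis
  then obtain d where d: "\<And>n c. nrm (d n c) \<le> 1"
    "\<And>n c x. norm (comb n c x) \<le> 2 * norm (comb n c (d n c)) * nrm x"
    by metis
  \<comment> \<open>One almost norming vector for each combination with coefficients in
    \<open>R\<close>. Extensional coefficient functions on \<open>{..<n}\<close> keep the index set
    countable.\<close>
  define D where "D = (\<Union>n. d n ` (PiE {..<n} (\<lambda>_. R)))"
  have "countable D" unfolding D_def using R(1) by (intro countable_UN countable_image countable_PiE) auto
  have approx: "\<exists>r\<in>PiE {..<n} (\<lambda>_. R). \<forall>x. norm (comb n c x - comb n r x) \<le> e * nrm x"
    if "e > 0" for n c e
  proof -
    \<comment> \<open>The \<open>n\<close> errors add up to at most \<open>e\<close>; dividing by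
      \<open>n + 1\<close> also covers \<open>n = 0\<close>.\<close>
    have "\<forall>i. \<exists>r\<in>R. norm (c i - r) < e / (n + 1)" using R(2) that by simp
    then obtain r where r: "\<And>i. r i \<in> R" "\<And>i. norm (c i - r i) < e / (n + 1)" by metis
    have "norm (comb n c x - comb n (restrict r {..<n}) x) \<le> e * nrm x" for x
    proof -
      have "comb n c x - comb n (restrict r {..<n}) x = (\<Sum>i<n. (c i - r i) * f i x)"
        by (simp add: comb_def left_diff_distrib sum_subtractf)
      also have "norm \<dots> \<le> (\<Sum>i<n. e / (n + 1) * nrm x)"
        unfolding norm_mult using that
        by (intro order_trans[OF norm_sum] sum_mono) (simp only: norm_mult,
          intro mult_mono less_imp_le[OF r(2)] f_le, simp_all)
      also have "\<dots> \<le> e * nrm x"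
        using that nrm_nonneg[of x] by (simp add: field_simps)
      finally show ?thesis .
    qed
    moreover have "restrict r {..<n} \<in> PiE {..<n} (\<lambda>_. R)" using r(1) by auto
    ultimately show ?thesis by blast
  qed
  let ?M = "{x. \<forall>i. f i x = 0}"
  have "\<exists>w\<in>span (D \<union> ?M). nrm (x - w) < e" if "e > 0" for x e
  proof (rule ccontr)
    assume "\<not> ?thesis"
    then have far: "\<And>w. w \<in> span (D \<union> ?M) \<Longrightarrow> e \<le> nrm (x - w)" by force
    obtain u where u: "\<And>x y. u (x + y) = u x + u y" "\<And>c x. u (scale c x) = c * u x"
      "\<And>x. norm (u x) \<le> nrm x" "\<And>w. w \<in> span (D \<union> ?M) \<Longrightarrow> u w = 0" "u x \<noteq> 0"
      using Hahn_Banach_separation[OF subspace_span \<open>e > 0\<close> far] by blast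
    have u_dual: "u \<in> dual scale nrm" using u(1-3) by (intro dualI[of _ 1]) auto
    \<comment> \<open>Approximating \<open>u\<close> in norm and rounding the coefficients cost
      \<open>t\<close> each, so \<open>2 * t\<close>. As \<open>u\<close> vanishes at
      \<open>d n r\<close>, the rounded combination is at most \<open>2 * t\<close> there, hence has
      norm at most \<open>4 * t\<close> by the factor 2 in the choice of \<open>d\<close>. Together
      this makes 6.\<close>
    have small: "norm (u x) \<le> 6 * t * nrm x" if "t > 0" for t
    proof -
      have "\<exists>g\<in>G. operator_norm nrm norm (u - g) < t"
      proof (rule ccontr)
        assume "\<not> ?thesis"
        then have far_G: "\<And>g. g \<in> G \<Longrightarrow> t \<le> operator_norm nrm norm (u - g)" by force
        have "fun_vs.subspace G" unfolding G_def by (rule subspace_lincombs)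
        then obtain y where y: "\<And>g. g \<in> G \<Longrightarrow> g y = 0" "u y \<noteq> 0"
          using reflexive_separation[OF refl u_dual _ _ \<open>t > 0\<close> far_G] comb_dual G_eq by blast
        have "f i y = 0" for i
        proof -
          have "f i = comb (Suc i) (\<lambda>j. if j = i then 1 else 0)"
            by (auto simp: comb_def if_distrib[of "\<lambda>a. a * _"] cong: if_cong)
          then show ?thesis using y(1) G_eq by blast
        qed
        then show False using u(4)[of y] y(2) by (simp add: span_base)
      qed
      then obtain n c where nc: "operator_norm nrm norm (u - comb n c) < t"
        unfolding G_eq by blast
      obtain r where r: "r \<in> PiE {..<n} (\<lambda>_. R)" "\<And>x. norm (comb n c x - comb n r x) \<le> t * nrm x"
        using approx[OF \<open>t > 0\<close>] by blast
      have "u - comb n c \<in> dual scale nrm"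
        using u_dual comb_dual subspace_dual by (intro fun_vs.subspace_diff)
      then have "norm ((u - comb n c) y) \<le> operator_norm nrm norm (u - comb n c) * nrm y" for y
        by (rule dual_le)
      then have *: "norm (u y - comb n c y) \<le> t * nrm y" for y
        using mult_right_mono[OF less_imp_le[OF nc] nrm_nonneg[of y]] order_trans
        by (auto simp: fun_diff_def)
      have **: "norm (u y - comb n r y) \<le> 2 * t * nrm y" for y
        using *[of y] r(2)[of y] norm_triangle_ineq[of "u y - comb n c y" "comb n c y - comb n r y"]
        by simp
      have "d n r \<in> D" using r(1) unfolding D_def by blast
      then have "u (d n r) = 0" using u(4) by (simp add: span_base)
      then have "norm (comb n r (d n r)) \<le> 2 * t * nrm (d n r)" using **[of "d n r"] by simp
      also have "\<dots> \<le> 2 * t * 1" using d(1) that by (intro mult_left_mono) auto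
      finally have "2 * norm (comb n r (d n r)) * nrm x \<le> 4 * t * nrm x"
        using nrm_nonneg by (intro mult_right_mono) auto
      then have "norm (comb n r x) \<le> 4 * t * nrm x" using d(2)[of n r x] by linarith
      moreover have "norm (u x) \<le> norm (u x - comb n r x) + norm (comb n r x)"
        using norm_triangle_ineq[of "u x - comb n r x" "comb n r x"] by simp
      ultimately show ?thesis using **[of x] by linarith
    qed
    have "norm (u x) \<le> 0"
    proof (rule field_le_epsilon)
      fix t :: real assume "t > 0"
      have "nrm x \<ge> 0" by (rule nrm_nonneg)
      have "norm (u x) \<le> 6 * (t / (6 * (nrm x + 1))) * nrm x"
        using \<open>t > 0\<close> \<open>nrm x \<ge> 0\<close> by (intro small) simp
      also have "\<dots> = t * (nrm x / (nrm x + 1))"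
        using \<open>nrm x \<ge> 0\<close> by (simp add: divide_simps)
      also have "\<dots> \<le> t * 1"
        using \<open>t > 0\<close> \<open>nrm x \<ge> 0\<close> by (intro mult_left_mono) simp_all
      finally show "norm (u x) \<le> 0 + t" by simp
    qed
    then show False using u(5) by simp
  qed
  with \<open>countable D\<close> show thesis using that by blast
qed

end

section \<open>Diagonal subsequences and the pointwise null sequence\<close>

lemma Cauchy_Suc_diff_tendsto_0:
  fixes X :: "nat \<Rightarrow> 'a::real_normed_vector"
  assumes "Cauchy X"
  shows "(\<lambda>n. X (Suc n) - X n) \<longlonglongrightarrow> 0"
proof (rule LIMSEQ_I)
  fix e :: real assume "e > 0"
  then obtain M where "\<And>m n. m \<ge> M \<Longrightarrow> n \<ge> M \<Longrightarrow> norm (X m - X n) < e"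
    using CauchyD[OF assms] by blast
  then show "\<exists>M. \<forall>n\<ge>M. norm (X (Suc n) - X n - 0) < e"
    by (metis diff_zero le_SucI)
qed

context normed_vs
begin

lemma diagonal_Cauchy_subseq:
  fixes f :: "nat \<Rightarrow> 'a \<Rightarrow> 'k"
  assumes f_le: "\<And>i y. norm (f i y) \<le> nrm y" and "countable D"
  obtains s :: "nat \<Rightarrow> nat" where "strict_mono s"
    "\<And>d. d \<in> D \<Longrightarrow> (\<lambda>n. f (s (Suc n)) d - f (s n) d) \<longlonglongrightarrow> 0"
proof -
  \<comment> \<open>Inserting 0 makes the enumerated set nonempty even when \<open>D\<close> is
    empty.\<close>
  define e where "e = from_nat_into (insert 0 D)"
  define P where "P k s \<longleftrightarrow> Cauchy (\<lambda>n. f (s n) (e k))" for k and s :: "nat \<Rightarrow> nat"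
  interpret subseqs P
  proof
    fix k and s :: "nat \<Rightarrow> nat" assume "strict_mono s"
    obtain r where "strict_mono (r :: nat \<Rightarrow> nat)" "Cauchy ((\<lambda>n. f (s n) (e k)) \<circ> r)"
      using bounded_scalars_Cauchy_subseq[of "\<lambda>n. f (s n) (e k)"] f_le by blast
    then show "\<exists>r. strict_mono r \<and> P k (s \<circ> r)" by (auto simp: P_def o_def)
  qed
  have "P k (diagseq \<circ> (+) (Suc k))" for k
    by (rule diagseq_holds) (use Cauchy_subseq_Cauchy in \<open>auto simp: P_def o_def\<close>)
  \<comment> \<open>The diagonal sequence is a subsequence of the one selected for
    \<open>e k\<close> only from index \<open>Suc k\<close> on; the shift does not affect the limit
    and is removed below.\<close>
  then have shifted: "(\<lambda>n. f (diagseq (Suc k + Suc n)) (e k) - f (diagseq (Suc k + n)) (e k)) \<longlonglongrightarrow> 0" for k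
    unfolding P_def o_def by (rule Cauchy_Suc_diff_tendsto_0)
  have "(\<lambda>n. f (diagseq (Suc (n + Suc k))) (e k) - f (diagseq (n + Suc k)) (e k)) \<longlonglongrightarrow> 0" for k
    using shifted[of k] by (simp add: add.commute)
  then have "(\<lambda>n. f (diagseq (Suc n)) (e k) - f (diagseq n) (e k)) \<longlonglongrightarrow> 0" for k
    by (rule LIMSEQ_offset)
  moreover have "\<exists>k. e k = d" if "d \<in> D" for d
    unfolding e_def using \<open>countable D\<close> that by (intro from_nat_into_surj) auto
  ultimately show thesis
    using that[OF subseq_diagseq] by metis
qed

text \<open>The reflexive case of the Josefson-Nissenzweig theorem.\<close>

lemma pointwise_null_not_norm_null:
  assumes inf: "infinite_dimensional scale" and refl: "reflexive scale nrm"
  obtains h :: "nat \<Rightarrow> 'a \<Rightarrow> 'k"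
  where "\<And>n. h n \<in> dual scale nrm" "\<And>x. (\<lambda>n. h n x) \<longlonglongrightarrow> 0"
    "\<And>n. \<exists>y. nrm y = 1 \<and> norm (h n y) = 1"
proof -
  obtain x :: "nat \<Rightarrow> 'a" and f :: "nat \<Rightarrow> 'a \<Rightarrow> 'k"
    where xf: "\<And>n. nrm (x n) = 1" "\<And>n. f n \<in> dual scale nrm" "\<And>n y. norm (f n y) \<le> nrm y"
    "\<And>n. norm (f n (x n)) = 1" "\<And>n i. i < n \<Longrightarrow> f i (x n) = 0"
    using triangular_system[OF inf] by blast
  let ?M = "{x. \<forall>i. f i x = 0}"
  obtain D where D: "countable D"
    "\<And>x e. e > 0 \<Longrightarrow> \<exists>w\<in>span (D \<union> ?M). nrm (x - w) < e"
    using countable_complement_of_kernel[of f, OF refl xf(2,3)] by blast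
  obtain s :: "nat \<Rightarrow> nat" where s: "strict_mono s"
    "\<And>d. d \<in> D \<Longrightarrow> (\<lambda>n. f (s (Suc n)) d - f (s n) d) \<longlonglongrightarrow> 0"
    using diagonal_Cauchy_subseq[of f D, OF xf(3) D(1)] by blast
  \<comment> \<open>These differences tend to 0 on \<open>D\<close> by the choice of
    \<open>s\<close> and are 0 on \<open>?M\<close>, while triangularity gives modulus 1 at
    \<open>x (s (Suc n))\<close>.\<close>
  define h where "h n y = f (s (Suc n)) y - f (s n) y" for n y
  have h_dual: "h n \<in> dual scale nrm" for n
    using dual_lincomb[OF xf(2) xf(2), of 1 "s (Suc n)" "-1" "s n"] by (simp add: h_def[abs_def])
  have h_le: "norm (h n y) \<le> 2 * nrm y" for n y
    using norm_triangle_ineq4[of "f (s (Suc n)) y" "f (s n) y"] xf(3)[of "s (Suc n)" y] xf(3)[of "s n" y]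
    by (simp add: h_def)
  let ?Z = "{y. (\<lambda>n. h n y) \<longlonglongrightarrow> 0}"
  have "subspace ?Z"
    unfolding subspace_def
    by (auto simp: dual_zero[OF h_dual] dual_add[OF h_dual] dual_scale[OF h_dual]
      intro: tendsto_add_zero tendsto_mult_right_zero)
  moreover have "D \<union> ?M \<subseteq> ?Z" using s(2) by (auto simp: h_def)
  ultimately have Z: "span (D \<union> ?M) \<subseteq> ?Z" by (intro span_minimal)
  \<comment> \<open>The uniform bound 2 extends the convergence from a dense subspace to the whole
    space: an approximation within \<open>e / 4\<close> costs less than
    \<open>e / 2\<close>.\<close>
  have "(\<lambda>n. h n y) \<longlonglongrightarrow> 0" for y
  proof (rule LIMSEQ_I)
    fix e :: real assume "e > 0"
    then obtain w where w: "w \<in> span (D \<union> ?M)" "nrm (y - w) < e / 4"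
      using D(2)[of "e / 4"] by auto
    then have "(\<lambda>n. h n w) \<longlonglongrightarrow> 0" using Z by blast
    then obtain N where N: "\<And>n. n \<ge> N \<Longrightarrow> norm (h n w) < e / 2"
      using LIMSEQ_D[of _ 0 "e / 2"] \<open>e > 0\<close> by auto
    have "norm (h n y) < e" if "n \<ge> N" for n
      using N[OF that] h_le[of n "y - w"] w(2) norm_triangle_ineq[of "h n (y - w)" "h n w"]
      by (simp add: dual_diff[OF h_dual])
    then show "\<exists>N. \<forall>n\<ge>N. norm (h n y - 0) < e" by auto
  qed
  moreover have "nrm (x (s (Suc n))) = 1 \<and> norm (h n (x (s (Suc n)))) = 1" for n
    using xf strict_monoD[OF s(1), of n "Suc n"] by (simp add: h_def)
  ultimately show thesis using that h_dual by blast
qed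

end

section \<open>Renorming\<close>

lemma equivalent_norm_topology:
  assumes "normed_vs s n1" "normed_vs s n2"
    and "\<And>x. n1 x \<le> A * n2 x" "\<And>x. n2 x \<le> B * n1 x"
  shows "norm_topology n1 = norm_topology n2"
proof -
  have *: "openin (norm_topology m2) U" if m: "normed_vs s m1" "normed_vs s m2" "\<And>x. m1 x \<le> C * m2 x"
    and U: "openin (norm_topology m1) U" for m1 m2 C U
  proof -
    interpret m1: normed_vs s m1 by fact
    interpret m2: normed_vs s m2 by fact
    interpret M1: Metric_space UNIV "\<lambda>x y. m1 (x - y)" by (rule m1.Metric_space_nrm)
    interpret M2: Metric_space UNIV "\<lambda>x y. m2 (x - y)" by (rule m2.Metric_space_nrm)
    show ?thesis
      unfolding norm_topology_def M2.openin_mtopology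
    proof (intro conjI allI impI)
      fix x assume "x \<in> U"
      then obtain r where r: "r > 0" "M1.mball x r \<subseteq> U"
        using U unfolding norm_topology_def M1.openin_mtopology by blast
      \<comment> \<open>The sign of \<open>C\<close> is unknown; \<open>\<bar>C\<bar> + 1\<close> is
        a positive constant above it.\<close>
      have "M2.mball x (r / (\<bar>C\<bar> + 1)) \<subseteq> M1.mball x r"
      proof
        fix y assume "y \<in> M2.mball x (r / (\<bar>C\<bar> + 1))"
        then have "(\<bar>C\<bar> + 1) * m2 (x - y) < r" by (simp add: field_simps)
        moreover have "C * m2 (x - y) \<le> (\<bar>C\<bar> + 1) * m2 (x - y)"
          using m2.nrm_nonneg by (intro mult_right_mono) auto
        ultimately show "y \<in> M1.mball x r" using m(3)[of "x - y"] by simp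
      qed
      then show "\<exists>r>0. M2.mball x r \<subseteq> U"
        using r by (intro exI[of _ "r / (\<bar>C\<bar> + 1)"]) auto
    qed simp
  qed
  show ?thesis
    unfolding topology_eq using *[OF assms(1,2,3)] *[OF assms(2,1,4)] by blast
qed

lemma equivalent_norm_banach:
  assumes "banach_vs s n1" "normed_vs s n2"
    and "\<And>x. n1 x \<le> A * n2 x" "\<And>x. n2 x \<le> B * n1 x"
  shows "banach_vs s n2"
proof -
  interpret n1: banach_vs s n1 by fact
  interpret n2: normed_vs s n2 by fact
  interpret M1: Metric_space UNIV "\<lambda>x y. n1 (x - y)" by (rule n1.Metric_space_nrm)
  interpret M2: Metric_space UNIV "\<lambda>x y. n2 (x - y)" by (rule n2.Metric_space_nrm)
  have top: "M1.mtopology = M2.mtopology"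
    using equivalent_norm_topology[OF n1.normed_vs_axioms assms(2-4)] by (simp add: norm_topology_def)
  have "M1.MCauchy \<sigma>" if \<sigma>: "M2.MCauchy \<sigma>" for \<sigma>
    unfolding M1.MCauchy_def
  proof (intro conjI allI impI)
    fix e :: real assume "e > 0"
    then have "e / (\<bar>A\<bar> + 1) > 0" by simp
    then obtain N where N: "\<And>m n. N \<le> m \<Longrightarrow> N \<le> n \<Longrightarrow> n2 (\<sigma> m - \<sigma> n) < e / (\<bar>A\<bar> + 1)"
      using \<sigma> unfolding M2.MCauchy_def by meson
    have "n1 (\<sigma> m - \<sigma> n) < e" if "N \<le> m" "N \<le> n" for m n
    proof -
      have "n1 (\<sigma> m - \<sigma> n) \<le> A * n2 (\<sigma> m - \<sigma> n)" by (rule assms)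
      also have "\<dots> \<le> (\<bar>A\<bar> + 1) * n2 (\<sigma> m - \<sigma> n)"
        using n2.nrm_nonneg by (intro mult_right_mono) auto
      also have "\<dots> < e" using N[OF that] by (simp add: field_simps)
      finally show ?thesis .
    qed
    then show "\<exists>N. \<forall>m n. N \<le> m \<longrightarrow> N \<le> n \<longrightarrow> n1 (\<sigma> m - \<sigma> n) < e" by blast
  qed simp
  then have "M2.mcomplete"
    using n1.complete unfolding M1.mcomplete_def M2.mcomplete_def top by blast
  then show ?thesis by unfold_locales
qed

text \<open>Late coordinates stay below half of the supremum, so it is a maximum over finitely many.
  Attainment of a norm in \<open>c0\<close> is thereby reduced to a single coordinate.\<close>

lemma c0_norm_attained:
  fixes v :: "'k::real_or_complex c0"
  assumes "c0_norm v > 0"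
  obtains n where "norm (c0_seq v n) = c0_norm v"
proof (rule ccontr)
  assume "\<not> thesis"
  with that norm_c0_seq_le have lt: "norm (c0_seq v n) < c0_norm v" for n
    by (metis less_eq_real_def)
  obtain N where "\<And>n. n \<ge> N \<Longrightarrow> norm (c0_seq v n) < c0_norm v / 2"
    using LIMSEQ_D[OF c0_seq_tendsto[of v], of "c0_norm v / 2"] assms by auto
  then have N: "\<And>n. n \<ge> N \<Longrightarrow> norm (c0_seq v n) \<le> c0_norm v / 2"
    by (simp add: less_imp_le)
  have half: "c0_norm v / 2 < c0_norm v" using assms by simp
  obtain C where "C < c0_norm v" "\<And>n. norm (c0_seq v n) \<le> C"
    using bounded_above_strict_sup[of "\<lambda>n. norm (c0_seq v n)", OF lt half N] by blast
  then show False using c0_norm_le[of v C] by simp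
qed

section \<open>Failure of the weak maximizing property after renorming\<close>

context normed_vs
begin

text \<open>The hypothesis \<open>lift\<close> is all that is required of the geometry: values of
  \<open>k n\<close> on the unit ball recur on the part of the sphere where \<open>g\<close> is 1.
  The lower bound \<open>c\<close> ensures that dividing by the norms preserves pointwise
  convergence to 0.\<close>

lemma operator_into_c0_failing_WMP:
  fixes k :: "nat \<Rightarrow> 'a \<Rightarrow> 'k"
  assumes k: "\<And>n. k n \<in> dual scale nrm" "\<And>x. (\<lambda>n. k n x) \<longlonglongrightarrow> 0"
    and c: "c > 0" "\<And>n. c \<le> operator_norm nrm norm (k n)"
    and g: "g \<in> dual scale nrm"
    and lift: "\<And>n y. nrm y \<le> 1 \<Longrightarrow> \<exists>z. nrm z = 1 \<and> g z = 1 \<and> k n z = k n y"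
  shows "\<not> weak_maximizing_property scale nrm (c0_scale :: 'k \<Rightarrow> 'k c0 \<Rightarrow> 'k c0) c0_norm"
proof -
  define a where "a n = operator_norm nrm norm (k n)" for n
  \<comment> \<open>The denominator starts at 2, so that \<open>b 0 = 1 / 2\<close> is positive like
    all later factors.\<close>
  define b where "b n = 1 - 1 / real (n + 2)" for n
  have a: "c \<le> a n" for n using c(2) by (simp add: a_def)
  then have a_pos: "a n > 0" for n using c(1) order_less_le_trans by blast
  have b: "0 < b n" "b n < 1" for n by (simp_all add: b_def field_simps)
  have b_lim: "b \<longlonglongrightarrow> 1"
  proof -
    have "(\<lambda>n. 1 - 1 / real (n + 2)) \<longlonglongrightarrow> 1 - 0"
      by (intro tendsto_diff tendsto_const LIMSEQ_ignore_initial_segment lim_const_over_n)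
    then show ?thesis by (simp add: b_def[abs_def])
  qed
  define t where "t x n = of_real (b n / a n) * k n x" for x n
  have norm_t: "norm (t x n) = b n / a n * norm (k n x)" for x n
    using a_pos[of n] b[of n] by (simp add: t_def norm_mult norm_divide)
  have "(\<lambda>n. t x n) \<longlonglongrightarrow> 0" for x
  proof (rule Lim_null_comparison)
    show "\<forall>\<^sub>F n in sequentially. norm (t x n) \<le> 1 / c * norm (k n x)"
    proof (intro always_eventually allI)
      fix n
      have "b n / a n \<le> 1 / c"
        using a[of n] a_pos[of n] b[of n] c(1) by (intro frac_le) auto
      then show "norm (t x n) \<le> 1 / c * norm (k n x)"
        unfolding norm_t by (rule mult_right_mono) simp
    qed
    show "(\<lambda>n. 1 / c * norm (k n x)) \<longlonglongrightarrow> 0"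
      using k(2)[of x] by (intro tendsto_mult_right_zero tendsto_norm_zero)
  qed
  define T where "T x = Abs_c0 (t x)" for x
  have T: "c0_seq (T x) n = t x n" for x n
    unfolding T_def using \<open>\<And>x. t x \<longlonglongrightarrow> 0\<close> by (simp add: Abs_c0_inverse)
  have t_le: "norm (t x n) \<le> b n * nrm x" for x n
    using dual_le(2)[OF k(1), of n x] a_pos[of n] b[of n]
    by (simp add: norm_t a_def[symmetric] field_simps)
  have T_le: "c0_norm (T x) \<le> nrm x" for x
  proof (rule c0_norm_le)
    fix n
    have "b n * nrm x \<le> 1 * nrm x" using b[of n] nrm_nonneg by (intro mult_right_mono) auto
    then show "norm (c0_seq (T x) n) \<le> nrm x" using t_le[of x n] by (simp add: T)
  qed
  have bounded: "bounded_operator scale nrm c0_scale c0_norm T"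
    unfolding bounded_operator_def Vector_Spaces.linear_iff
  proof (intro conjI allI)
    show "T (x + y) = T x + T y" for x y
      by (simp add: c0_seq_inject[symmetric] fun_eq_iff T plus_c0.rep_eq t_def dual_add[OF k(1)] distrib_left add_divide_distrib)
    show "T (scale r x) = c0_scale r (T x)" for r x
      by (simp add: c0_seq_inject[symmetric] fun_eq_iff T c0_scale.rep_eq t_def dual_scale[OF k(1)])
    show "\<exists>C. \<forall>x. c0_norm (T x) \<le> C * nrm x"
      using T_le by (intro exI[of _ 1]) simp
  qed (rule vector_space_axioms c0.vector_space_axioms)+
  have "\<exists>z. nrm z = 1 \<and> g z = 1 \<and> b n * b n \<le> c0_norm (T z)" for n
  proof -
    \<comment> \<open>Reusing \<open>b n < 1\<close> as the tolerance yields a vector at which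
      \<open>k n\<close> reaches the fraction \<open>b n\<close> of its norm; after scaling, the
      coordinate has modulus at least \<open>b n * b n\<close>, which tends to 1.\<close>
    have "\<not> a n \<le> b n * a n" using a_pos[of n] b[of n] by simp
    then obtain y where y: "nrm y \<le> 1" "b n * a n \<le> norm (k n y)"
      unfolding a_def using operator_norm_le[of norm "k n"] by force
    obtain z where z: "nrm z = 1" "g z = 1" "k n z = k n y" using lift[OF y(1)] by blast
    have "b n * b n = b n / a n * (b n * a n)" using a_pos[of n] by simp
    also have "\<dots> \<le> norm (t z n)"
      unfolding norm_t z(3) using y(2) a_pos[of n] b[of n] by (intro mult_left_mono) auto
    also have "\<dots> \<le> c0_norm (T z)" using norm_c0_seq_le[of "T z" n] by (simp add: T)
    finally show ?thesis using z by blast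
  qed
  then obtain z where z: "\<And>n. nrm (z n) = 1" "\<And>n. g (z n) = 1" "\<And>n. b n * b n \<le> c0_norm (T (z n))"
    by metis
  have Tz: "c0_norm (T (z n)) \<le> 1" for n using T_le[of "z n"] z(1) by simp
  have bb: "(\<lambda>n. b n * b n) \<longlonglongrightarrow> 1" using tendsto_mult[OF b_lim b_lim] by simp
  have opn: "operator_norm nrm c0_norm T = 1"
  proof (rule antisym)
    show "operator_norm nrm c0_norm T \<le> 1"
      using T_le order_trans by (blast intro: operator_norm_le)
    have "b n * b n \<le> operator_norm nrm c0_norm T" for n
      using le_operator_norm[of c0_norm T 1 "z n"] T_le z(1)[of n] z(3)[of n] by simp
    then show "1 \<le> operator_norm nrm c0_norm T"
      by (intro LIMSEQ_le_const2[OF bb]) auto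
  qed
  have "(\<lambda>n. c0_norm (T (z n))) \<longlonglongrightarrow> 1"
    by (rule tendsto_sandwich[OF _ _ bb tendsto_const]) (simp_all add: z(3) Tz)
  then have "maximizing_sequence nrm c0_norm T z"
    using z(1) opn by (simp add: maximizing_sequence_def)
  moreover have "\<not> weakly_null scale nrm z"
    unfolding weakly_null_def using g z(2) by (auto intro!: bexI[of _ g] simp: LIMSEQ_const_iff)
  moreover have "\<not> attains_norm nrm c0_norm T"
  proof
    assume "attains_norm nrm c0_norm T"
    then obtain x where x: "nrm x = 1" "c0_norm (T x) = 1"
      by (auto simp: attains_norm_def opn)
    then obtain n where "norm (c0_seq (T x) n) = 1"
      using c0_norm_attained[of "T x"] by auto
    then show False using t_le[of x n] b(2)[of n] x(1) by (simp add: T)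
  qed
  ultimately show ?thesis
    using bounded unfolding weak_maximizing_property_def by blast
qed

text \<open>The maximum norm of the decomposition into the line through \<open>x0\<close> and \<open>ker g\<close>, when \<open>g x0 = 1\<close>.\<close>

definition split_norm :: "('a \<Rightarrow> 'k) \<Rightarrow> 'a \<Rightarrow> 'a \<Rightarrow> real"
  where "split_norm g x0 x = max (norm (g x)) (nrm (x - scale (g x) x0))"

text \<open>Both constants 2 come from two summands: \<open>g\<close> and \<open>x0\<close> have
  norm at most 1, so subtracting \<open>scale (g x) x0\<close> at most doubles the norm, and
  conversely \<open>x\<close> is the sum of two parts each bounded by the maximum.\<close>

lemma
  assumes g: "g \<in> dual scale nrm" "\<And>x. norm (g x) \<le> nrm x" and x0: "nrm x0 = 1"
  shows split_norm_le: "split_norm g x0 x \<le> 2 * nrm x"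
    and le_split_norm: "nrm x \<le> 2 * split_norm g x0 x"
    and split_norm_normed_vs: "normed_vs scale (split_norm g x0)"
proof -
  have tri: "nrm (x - y) \<le> nrm x + nrm y" for x y
    using nrm_triangle[of x "- y"] by (simp add: nrm_minus)
  show "split_norm g x0 x \<le> 2 * nrm x"
    using tri[of x "scale (g x) x0"] g(2)[of x] nrm_nonneg[of x]
    by (simp add: split_norm_def nrm_scale x0)
  show le: "nrm x \<le> 2 * split_norm g x0 x" for x
    using nrm_triangle[of "x - scale (g x) x0" "scale (g x) x0"]
    by (simp add: split_norm_def nrm_scale x0)
  show "normed_vs scale (split_norm g x0)"
  proof
    fix x y and c
    have "nrm (x + y - scale (g (x + y)) x0)
        \<le> nrm (x - scale (g x) x0) + nrm (y - scale (g y) x0)"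
      using nrm_triangle[of "x - scale (g x) x0" "y - scale (g y) x0"]
      by (simp add: dual_add[OF g(1)] scale_left_distrib algebra_simps)
    moreover have "norm (g (x + y)) \<le> norm (g x) + norm (g y)"
      by (simp add: dual_add[OF g(1)] norm_triangle_ineq)
    ultimately show "split_norm g x0 (x + y) \<le> split_norm g x0 x + split_norm g x0 y"
      unfolding split_norm_def by linarith
    have "nrm (scale c x - scale (g (scale c x)) x0) = norm c * nrm (x - scale (g x) x0)"
      unfolding nrm_scale[symmetric] by (simp add: dual_scale[OF g(1)] scale_right_diff_distrib)
    then show "split_norm g x0 (scale c x) = norm c * split_norm g x0 x"
      by (simp add: split_norm_def dual_scale[OF g(1)] norm_mult max_mult_distrib_left)
    show "split_norm g x0 x = 0 \<longleftrightarrow> x = 0"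
      using le[of x] nrm_nonneg[of x] nrm_eq_0[of x]
      by (auto simp: split_norm_def dual_zero[OF g(1)] nrm_zero)
  qed
qed

lemma renorming_failing_WMP:
  assumes inf: "infinite_dimensional scale" and refl: "reflexive scale nrm"
  obtains N where "normed_vs scale N" "\<And>x. N x \<le> 2 * nrm x" "\<And>x. nrm x \<le> 2 * N x"
    "\<not> weak_maximizing_property scale N (c0_scale :: 'k \<Rightarrow> 'k c0 \<Rightarrow> 'k c0) c0_norm"
proof -
  obtain h :: "nat \<Rightarrow> 'a \<Rightarrow> 'k"
    where h: "\<And>n. h n \<in> dual scale nrm" "\<And>x. (\<lambda>n. h n x) \<longlonglongrightarrow> 0"
    "\<And>n. \<exists>y. nrm y = 1 \<and> norm (h n y) = 1"
    using pointwise_null_not_norm_null[OF inf refl] by blast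
  obtain x0 where x0: "nrm x0 = 1" using h(3) by blast
  obtain g0 where g0: "g0 \<in> dual scale nrm" "\<And>x. norm (g0 x) \<le> nrm x" "norm (g0 x0) = nrm x0"
    using ex_norming_functional[of x0] by blast
  define g where "g x = g0 x / g0 x0" for x
  have g_le: "norm (g x) \<le> nrm x" for x using g0(2,3) x0 by (simp add: g_def norm_divide)
  have g: "g \<in> dual scale nrm"
    using g0(1) g_le by (intro dualI[of _ 1]) (simp_all add: g_def dual_add dual_scale add_divide_distrib)
  have gx0: "g x0 = 1" using g0(3) x0 by (auto simp: g_def)
  let ?N = "split_norm g x0"
  note N_le = split_norm_le[OF g g_le x0] and le_N = le_split_norm[OF g g_le x0]
  interpret N: normed_vs scale ?N by (rule split_norm_normed_vs[OF g g_le x0])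
  have dual_N: "f \<in> dual scale ?N" if f: "f \<in> dual scale nrm" for f
  proof (rule N.dualI)
    fix x
    have "norm (f x) \<le> operator_norm nrm norm f * nrm x" by (rule dual_le[OF f])
    also have "\<dots> \<le> operator_norm nrm norm f * (2 * ?N x)"
      using le_N operator_norm_dual_nonneg[OF f] by (rule mult_left_mono)
    finally show "norm (f x) \<le> (2 * operator_norm nrm norm f) * ?N x" by (simp add: ac_simps)
  qed (use f in \<open>simp_all add: dual_add dual_scale\<close>)
  \<comment> \<open>Dropping the first \<open>M\<close> functionals makes the correction at
    \<open>x0\<close> smaller than 1/2, so at least 1/2 of the modulus 1 of \<open>h\<close>
    survives; the change of norm costs another factor 2, whence the bound 1/4.\<close>
  obtain M where "\<And>n. n \<ge> M \<Longrightarrow> norm (h n x0) < 1 / 2"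
    using LIMSEQ_D[OF h(2)[of x0], of "1 / 2"] by auto
  then have M: "norm (h (n + M) x0) < 1 / 2" for n by simp
  define k where "k n x = h (n + M) x - h (n + M) x0 * g x" for n x
  have k_dual: "k n \<in> dual scale nrm" for n
    using dual_lincomb[OF h(1) g, of 1 "n + M" "- h (n + M) x0"] by (simp add: k_def[abs_def])
  have k_x0: "k n x0 = 0" for n by (simp add: k_def gx0)
  have k_null: "(\<lambda>n. k n x) \<longlonglongrightarrow> 0" for x
  proof -
    have "(\<lambda>n. h n x - h n x0 * g x) \<longlonglongrightarrow> 0 - 0 * g x"
      by (intro tendsto_intros h(2))
    then show ?thesis
      unfolding k_def by (intro LIMSEQ_ignore_initial_segment) simp
  qed
  have k_norm: "1 / 4 \<le> operator_norm ?N norm (k n)" for n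
  proof -
    obtain y where y: "nrm y = 1" "norm (h (n + M) y) = 1" using h(3) by blast
    have "norm (h (n + M) x0 * g y) \<le> 1 / 2 * 1"
      unfolding norm_mult using M[of n] g_le[of y] y(1) by (intro mult_mono) auto
    then have "1 / 2 \<le> norm (k n y)"
      using norm_triangle_ineq2[of "h (n + M) y" "h (n + M) x0 * g y"] y(2) by (simp add: k_def)
    also have "\<dots> \<le> operator_norm ?N norm (k n) * ?N y"
      by (rule N.dual_le[OF dual_N[OF k_dual]])
    also have "\<dots> \<le> operator_norm ?N norm (k n) * 2"
      using N_le[of y] y(1) N.operator_norm_dual_nonneg[OF dual_N[OF k_dual]]
      by (intro mult_left_mono) auto
    finally show ?thesis by simp
  qed
  have lift: "\<exists>z. ?N z = 1 \<and> g z = 1 \<and> k n z = k n y" if "?N y \<le> 1" for n y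
  proof (intro exI conjI)
    \<comment> \<open>The component of \<open>y\<close> along the line is replaced by
      \<open>x0\<close>. The hyperplane component, of norm at most 1, is kept, so the maximum is
      exactly 1.\<close>
    let ?z = "x0 + (y - scale (g y) x0)"
    show gz: "g ?z = 1"
      by (simp add: dual_add[OF g] dual_diff[OF g] dual_scale[OF g] gx0)
    show "k n ?z = k n y"
      by (simp add: dual_add[OF k_dual] dual_diff[OF k_dual] dual_scale[OF k_dual] k_x0)
    show "?N ?z = 1"
      using that unfolding split_norm_def[of _ _ ?z] gz by (simp add: split_norm_def)
  qed
  have "\<not> weak_maximizing_property scale ?N (c0_scale :: 'k \<Rightarrow> 'k c0 \<Rightarrow> 'k c0) c0_norm"
    by (rule N.operator_into_c0_failing_WMP[where c = "1/4", OF dual_N[OF k_dual] k_null _ k_norm dual_N[OF g] lift])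
      simp_all
  with N.normed_vs_axioms N_le le_N show thesis using that by blast
qed

end

theorem proposition2p8:
  fixes sE :: "'k::real_or_complex \<Rightarrow> 'a::ab_group_add \<Rightarrow> 'a"
    and nE :: "'a \<Rightarrow> real"
  assumes "banach_vs sE nE"
    and "infinite_dimensional sE"
    and "reflexive sE nE"
  shows
    "(\<forall>(T :: 'a \<Rightarrow> 'k c0) (K :: 'a \<Rightarrow> 'k c0).
        bounded_operator sE nE c0_scale c0_norm T \<longrightarrow>
        compact_operator sE nE c0_scale c0_norm K \<longrightarrow>
        operator_norm nE c0_norm T < operator_norm nE c0_norm (\<lambda>x. T x + K x) \<longrightarrow>
        attains_norm nE c0_norm (\<lambda>x. T x + K x)) \<and>
     (\<exists>(sE' :: 'k \<Rightarrow> 'a \<Rightarrow> 'a) (nE' :: 'a \<Rightarrow> real).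
        banach_vs sE' nE' \<and>
        isomorphic_vs sE nE sE' nE' \<and>
        \<not> weak_maximizing_property sE' nE' (c0_scale :: 'k \<Rightarrow> 'k c0 \<Rightarrow> 'k c0) c0_norm)"
proof -
  interpret banach_vs sE nE by fact
  obtain N where N: "normed_vs sE N" "\<And>x. N x \<le> 2 * nE x" "\<And>x. nE x \<le> 2 * N x"
    "\<not> weak_maximizing_property sE N (c0_scale :: 'k \<Rightarrow> 'k c0 \<Rightarrow> 'k c0) c0_norm"
    using renorming_failing_WMP[OF assms(2,3)] by blast
  have "banach_vs sE N"
    by (rule equivalent_norm_banach[OF assms(1) N(1,3,2)])
  moreover have "isomorphic_vs sE nE sE N"
    unfolding isomorphic_vs_def
    using equivalent_norm_topology[OF normed_vs_axioms N(1,3,2)] vector_space_axioms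
    by (intro exI[of _ id]) (simp add: Vector_Spaces.linear_iff)
  ultimately show ?thesis
    using N(4) compact_perturbation_attains_norm[OF assms(3)] by blast
qed

end
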